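(* Let $t_1,\dots,t_m$ be real algebraic numbers, let $p=(p_j)_{j=1}^m$ be a probability vector, and set $\nu=\sum_{j=1}^m p_j\delta_{t_j}$. For any $h\in(0,H(p))$, there is a positive number $M$ depending on $h$, $t_1,\dots,t_m$ and $p_1,\dots,p_m$, such that $h_{\eta,\nu}\ge h$ for every nonzero algebraic number $\eta\in(-1,1)$ with $M(\eta)\ge M$.
   Context: $H(p)=-\sum_{j=1}^m p_j\log p_j$ (with $0\log0=0$). For $\eta\in\mathbb{C}$ with $0<|\eta|<1$, the Garsia entropy is $h_{\eta,\nu}=\lim_{n\to\infty}\frac1n H\big(\sum_{j=0}^{n-1}\xi_j\eta^j\big)$, where $(\xi_j)_{j\ge0}$ are independent random variables with common law $\nu$ and $H(X)=-\sum_x\mathbb{P}\{X=x\}\log\mathbb{P}\{X=x\}$ is the Shannon entropy of a discrete random variable; the limit always exists by subadditivity. For an algebraic number $\beta$ with minimal polynomial $f(X)=a_n\prod_{i=1}^n(X-\beta_i)\in\mathbb{Z}[X]$ with coprime integer coefficients, the Mahler measure is $M(\beta)=|a_n|\prod_{i=1}^n\max\{1,|\beta_i|\}$.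
   Formalization: The numbers t_1,…,t_m are assumed pairwise distinct; without this the claim fails, e.g. for t_1=t_2=0, p=(1/2,1/2), where h_{η,ν}=0 for every η although H(p)=log 2. *)

theory Defs
  imports
    "HOL-Probability.Probability"
    "Berlekamp_Zassenhaus.Mahler_Measure"
begin

text \<open>All logarithms are natural.  As \<open>ln 0 = 0\<close> (and \<open>0 * y = 0\<close>) in HOL, the convention
  \<open>0 log 0 = 0\<close> is built in.\<close>

definition entropy_vector :: "nat \<Rightarrow> (nat \<Rightarrow> real) \<Rightarrow> real" where
  "entropy_vector m p = - (\<Sum>j\<in>{1..m}. p j * ln (p j))"

text \<open>The entropy of a discrete random variable, as a function of its law.  The sum is only
  meaningful if it converges; below it is applied to finitely supported laws.\<close>

definition shannon_entropy :: "'a pmf \<Rightarrow> real" where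
  "shannon_entropy X = - (\<Sum>\<^sub>\<infinity>x. pmf X x * ln (pmf X x))"

text \<open>The law \<open>p\<^sub>1 \<delta>\<^bsub>t\<^sub>1\<^esub> + \<dots> + p\<^sub>m \<delta>\<^bsub>t\<^sub>m\<^esub>\<close>.\<close>

definition discrete_law :: "nat \<Rightarrow> (nat \<Rightarrow> real) \<Rightarrow> (nat \<Rightarrow> real) \<Rightarrow> real pmf" where
  "discrete_law m p t = embed_pmf (\<lambda>x. \<Sum>j\<in>{1..m}. p j * indicator {t j} x)"

lemma pmf_discrete_law:
  assumes "\<And>j. j \<in> {1..m} \<Longrightarrow> 0 \<le> p j" "(\<Sum>j\<in>{1..m}. p j) = 1"
  shows "pmf (discrete_law m p t) x = (\<Sum>j\<in>{1..m}. p j * indicator {t j} x)"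
  unfolding discrete_law_def
proof (rule pmf_embed_pmf)
  show "0 \<le> (\<Sum>j\<in>{1..m}. p j * indicator {t j} x)" for x
    using assms(1) by (intro sum_nonneg mult_nonneg_nonneg) auto
  have "(\<integral>\<^sup>+x. ennreal (\<Sum>j\<in>{1..m}. p j * indicator {t j} x) \<partial>count_space UNIV)
      = (\<integral>\<^sup>+x. (\<Sum>j\<in>{1..m}. ennreal (p j) * indicator {t j} x) \<partial>count_space UNIV)"
  proof (intro nn_integral_cong)
    fix x
    have "ennreal (\<Sum>j\<in>{1..m}. p j * indicator {t j} x)
        = (\<Sum>j\<in>{1..m}. ennreal (p j * indicator {t j} x))"
      using assms(1) by (subst sum_ennreal) auto
    also have "\<dots> = (\<Sum>j\<in>{1..m}. ennreal (p j) * indicator {t j} x)"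
      by (intro sum.cong) (auto simp: indicator_def)
    finally show "ennreal (\<Sum>j\<in>{1..m}. p j * indicator {t j} x)
        = (\<Sum>j\<in>{1..m}. ennreal (p j) * indicator {t j} x)" .
  qed
  also have "\<dots> = (\<Sum>j\<in>{1..m}. ennreal (p j))"
    by (subst nn_integral_sum) (auto simp: nn_integral_cmult)
  also have "\<dots> = 1"
    using assms by (subst sum_ennreal) auto
  finally show "(\<integral>\<^sup>+x. ennreal (\<Sum>j\<in>{1..m}. p j * indicator {t j} x) \<partial>count_space UNIV) = 1" .
qed

text \<open>The law of \<open>\<xi>\<^sub>0 + \<xi>\<^sub>1 \<eta> + \<dots> + \<xi>\<^bsub>n-1\<^esub> \<eta>\<^bsup>n-1\<^esup>\<close> for independent \<open>\<xi>\<^sub>j\<close> with law \<open>\<nu>\<close>: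
  \<open>Pi_pmf\<close> is the joint law of \<open>(\<xi>\<^sub>j)\<^bsub>j < n\<^esub>\<close>, its second argument being the irrelevant
  value at indices \<open>\<ge> n\<close>.\<close>

definition garsia_sum :: "complex \<Rightarrow> real pmf \<Rightarrow> nat \<Rightarrow> complex pmf" where
  "garsia_sum \<eta> \<nu> n =
     map_pmf (\<lambda>\<xi>. \<Sum>j<n. complex_of_real (\<xi> j) * \<eta> ^ j) (Pi_pmf {..<n} 0 (\<lambda>_. \<nu>))"

definition garsia_entropy :: "complex \<Rightarrow> real pmf \<Rightarrow> real" where
  "garsia_entropy \<eta> \<nu> = lim (\<lambda>n. 1 / real n * shannon_entropy (garsia_sum \<eta> \<nu> n))"

text \<open>The primitive integer multiple of the minimal polynomial over the rationals; the positive
  leading coefficient only fixes the sign.\<close>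

definition is_min_int_poly :: "complex \<Rightarrow> int poly \<Rightarrow> bool" where
  "is_min_int_poly \<beta> f \<longleftrightarrow>
     poly (of_int_poly f) \<beta> = 0 \<and> content f = 1 \<and> lead_coeff f > 0 \<and>
     (\<forall>g. g \<noteq> 0 \<and> poly (of_int_poly g) \<beta> = 0 \<longrightarrow> degree f \<le> degree g)"

lemma ex1_min_int_poly:
  assumes "algebraic \<beta>"
  shows "\<exists>!f. is_min_int_poly \<beta> f"
proof -
  define P where "P g \<longleftrightarrow> g \<noteq> 0 \<and> poly (of_int_poly g) \<beta> = 0" for g :: "int poly"
  obtain q where q: "\<And>i. Polynomial.coeff q i \<in> \<int>" "q \<noteq> 0" "poly q \<beta> = 0"
    using algebraicE[OF assms] by metis
  define q' where "q' = map_poly (\<lambda>c. \<lfloor>Re c\<rfloor>) q"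
  have "of_int_poly q' = q"
  proof (rule poly_eqI)
    fix i
    from q(1) obtain k where "Polynomial.coeff q i = of_int k" by (auto elim: Ints_cases)
    then show "Polynomial.coeff (of_int_poly q') i = Polynomial.coeff q i"
      by (simp add: q'_def coeff_map_poly)
  qed
  then have "P q'" using q by (auto simp: P_def)
  then obtain g where g: "P g" "\<And>h. P h \<Longrightarrow> degree g \<le> degree h"
    using ex_has_least_nat[of P q' degree] by blast
  define f where "f = Polynomial.smult (sgn (lead_coeff g)) (primitive_part g)"
  have g0: "g \<noteq> 0" using g by (simp add: P_def)
  then have c0: "content g > 0"
    by (metis content_eq_zero_iff normalize_content normalize_int_def abs_ge_zero order_less_le)
  have gf: "g = Polynomial.smult (sgn (lead_coeff g) * content g) f"
    using g0 by (simp add: f_def mult.assoc[symmetric])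
      (simp add: mult.commute[of _ "content g"] mult.assoc sgn_mult_self_eq)
  have "is_min_int_poly \<beta> f"
    unfolding is_min_int_poly_def
  proof (intro conjI allI impI)
    have "poly (of_int_poly g) \<beta> = of_int (sgn (lead_coeff g) * content g) * poly (of_int_poly f) \<beta>"
      by (subst gf) (simp only: of_int_hom.map_poly_hom_smult poly_smult)
    then show "poly (of_int_poly f) \<beta> = 0"
      using g(1) c0 g0 by (auto simp: P_def sgn_if split: if_splits)
    show "content f = 1"
      using g0 by (simp add: f_def sgn_if)
    have "lead_coeff g = sgn (lead_coeff g) * content g * lead_coeff f"
      by (metis gf lead_coeff_smult)
    then show "lead_coeff f > 0"
      using c0 g0 by (smt (verit) leading_coeff_0_iff mult_neg_pos mult_pos_pos mult_nonneg_nonneg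
          mult_nonpos_nonneg mult_nonneg_nonpos mult_nonpos_nonpos sgn_if)
    fix h :: "int poly" assume "h \<noteq> 0 \<and> poly (of_int_poly h) \<beta> = 0"
    then have "degree g \<le> degree h" using g(2) by (simp add: P_def)
    then show "degree f \<le> degree h"
      by (simp add: f_def sgn_if)
  qed
  moreover have "f1 = f2" if f12: "is_min_int_poly \<beta> f1" "is_min_int_poly \<beta> f2" for f1 f2
  proof -
    define a b where "a = lead_coeff f1" and "b = lead_coeff f2"
    have ab: "a > 0" "b > 0" using f12 by (auto simp: is_min_int_poly_def a_def b_def)
    then have nz: "f1 \<noteq> 0" "f2 \<noteq> 0" by (auto simp: a_def b_def)
    have deg: "degree f1 = degree f2"
      using f12 nz unfolding is_min_int_poly_def by (meson order_antisym)
    define d where "d = Polynomial.smult b f1 - Polynomial.smult a f2"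
    have root: "poly (of_int_poly d) \<beta> = 0"
      using f12 by (simp add: d_def is_min_int_poly_def hom_distribs)
    have "d = 0"
    proof (rule ccontr)
      assume d: "d \<noteq> 0"
      then have "degree f1 \<le> degree d"
        using f12(1) root by (simp add: is_min_int_poly_def)
      moreover have "degree d \<le> degree f1"
        unfolding d_def using deg by (intro degree_diff_le) auto
      moreover have "Polynomial.coeff d (degree f1) = 0"
        by (simp add: d_def a_def b_def deg)
      ultimately show False using d by (metis leading_coeff_0_iff order_antisym)
    qed
    then have eq: "Polynomial.smult b f1 = Polynomial.smult a f2" by (simp add: d_def)
    have "content (Polynomial.smult b f1) = b" "content (Polynomial.smult a f2) = a"
      using f12 ab by (simp_all add: is_min_int_poly_def)
    with eq have "a = b" by simp
    with eq have "Polynomial.smult b (f1 - f2) = 0" by (simp add: smult_diff_right)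
    with ab show ?thesis by simp
  qed
  ultimately show ?thesis by blast
qed

definition min_int_poly :: "complex \<Rightarrow> int poly" where
  "min_int_poly \<beta> = (THE f. is_min_int_poly \<beta> f)"

text \<open>On the right, \<open>mahler_measure\<close> is the measure of an integer polynomial, i.e. the absolute
  value of its leading coefficient times the product of \<open>max 1 \<bar>\<beta>\<^sub>i\<bar>\<close> over its complex roots
  \<open>\<beta>\<^sub>i\<close>, listed with multiplicity.\<close>

definition mahler_measure_alg :: "complex \<Rightarrow> real" where
  "mahler_measure_alg \<beta> = mahler_measure (min_int_poly \<beta>)"

end

theory Submission
  imports Defs "HOL-Real_Asymp.Real_Asymp"
begin

text \<open>Write \<open>X\<^sub>n = \<xi>\<^sub>0 + \<xi>\<^sub>1 \<eta> + \<dots> + \<xi>\<^bsub>n-1\<^esub> \<eta>\<^bsup>n-1\<^esup>\<close>.  Since \<open>H(X\<^bsub>n+1\<^esub>) = H(X\<^sub>n) + H(\<nu>) - H(\<xi>\<^sub>0 | X\<^bsub>n+1\<^esub>)\<close>, by Fano's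
  inequality it is enough to recover \<open>\<xi>\<^sub>0\<close> from \<open>X\<^bsub>n+1\<^esub>\<close> with small error probability.

  Let \<open>\<kappa>\<close> be an embedding of the field generated by the \<open>t\<^sub>j\<close>, and \<open>S\<close> a set of conjugates \<open>z\<close> of \<open>\<eta>\<close> in
  the open unit disc such that \<open>\<kappa>\<close> extends by \<open>\<eta> \<mapsto> z\<close>.  Then \<open>X\<^sub>n\<close> determines the values of
  \<open>f(x) = \<Sum> \<kappa>(\<xi>\<^sub>k) x\<^sup>k\<close> on \<open>S\<close>.  If \<open>B\<close> is the Blaschke product with zero set \<open>S\<close>, then
  \<open>f(0) - B(0) \<langle>f, B\<rangle>\<close> depends only on these values, and the variance of \<open>B(0) \<langle>f, B\<rangle>\<close> is at most
  a constant times \<open>\<bar>B(0)\<bar>\<^sup>2\<close>, the squared product of \<open>\<bar>z\<bar>\<close> over \<open>S\<close>.  Chebyshev's inequality does the rest,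
  provided that this product is small.

  If \<open>\<xi>\<^sub>0\<close> is not determined by \<open>X\<^sub>n\<close>, then \<open>\<eta>\<close> is a root of a polynomial whose coefficients are
  differences of the \<open>t\<^sub>j\<close> and whose constant term is nonzero.  Taking norms bounds the constant term \<open>a\<^sub>0\<close>
  of the minimal polynomial of \<open>\<eta>\<close>, and \<open>M(\<eta>)\<close> is \<open>\<bar>a\<^sub>0\<bar>\<close> divided by the product of all conjugates of
  modulus less than \<open>1\<close>.  So that product is small when \<open>M(\<eta>)\<close> is large, and by the pigeonhole principle
  this is already so for the conjugates belonging to one of the finitely many \<open>\<kappa>\<close>.\<close>

section \<open>Blaschke products\<close>

text \<open>State space realisation of the Blaschke factor \<open>(z - a) / (1 - cnj a z)\<close>: input \<open>f\<close>, state \<open>x\<close>,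
  output \<open>(1 - \<bar>a\<bar>\<^sup>2) x - a f\<close>.  Conservation of energy at each step makes it an isometry.\<close>

lemma blaschke_factor_isometry:
  fixes a :: complex and x y f g :: "nat \<Rightarrow> complex"
  assumes "x 0 = 0" "\<And>j. x (Suc j) = cnj a * x j + f j"
    and "y 0 = 0" "\<And>j. y (Suc j) = cnj a * y j + g j"
  defines "b \<equiv> 1 - a * cnj a"
  shows "b * x n * cnj (y n) + (\<Sum>j<n. (b * x j - a * f j) * cnj (b * y j - a * g j))
       = (\<Sum>j<n. f j * cnj (g j))"
proof (induction n)
  case 0
  then show ?case using assms by simp
next
  case (Suc n)
  have "b * x (Suc n) * cnj (y (Suc n)) + (b * x n - a * f n) * cnj (b * y n - a * g n)
      = b * x n * cnj (y n) + f n * cnj (g n)"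
    by (simp add: assms(2,4) b_def algebra_simps)
  then have "b * x (Suc n) * cnj (y (Suc n)) + (S + (b * x n - a * f n) * cnj (b * y n - a * g n))
      = (b * x n * cnj (y n) + S) + f n * cnj (g n)" for S
    by (metis add.assoc add.commute)
  then show ?case by (simp only: sum.lessThan_Suc Suc)
qed

text \<open>\<open>B\<close> is the Taylor sequence at 0 of the product of
  \<open>(z - a) / (1 - cnj a z)\<close> over \<open>as\<close>, built factor by factor. Each factor
  is isometric, so the square sums stay at most 1. Dividing
  \<open>(\<Prod>a\<leftarrow>as. [:-a, 1:]) * q\<close> by this product leaves \<open>q\<close>
  times the product of the \<open>1 - cnj a z\<close>. By the isometry, pairing with
  \<open>B\<close> thus becomes pairing that quotient with 1, which reads off its constant term
  \<open>q(0)\<close>.\<close>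

lemma ex_blaschke_functional:
  fixes as :: "complex list"
  assumes "\<And>a. a \<in> set as \<Longrightarrow> cmod a < 1"
  shows "\<exists>B :: nat \<Rightarrow> complex. (\<forall>n. (\<Sum>j<n. (cmod (B j))\<^sup>2) \<le> 1) \<and>
     (\<forall>q n. degree ((\<Prod>a\<leftarrow>as. [:-a, 1:]) * q) < n \<longrightarrow>
        (\<Sum>j<n. poly.coeff ((\<Prod>a\<leftarrow>as. [:-a, 1:]) * q) j * cnj (B j)) = poly.coeff q 0)"
  using assms
proof (induction as)
  case Nil
  define B :: "nat \<Rightarrow> complex" where "B j = (if j = 0 then 1 else 0)" for j
  have "(\<Sum>j<n. (cmod (B j))\<^sup>2) \<le> 1" for n
    by (simp add: B_def if_distrib if_distribR cong: if_cong)
  moreover have "(\<Sum>j<n. poly.coeff q j * cnj (B j)) = poly.coeff q 0" if "degree q < n" for q n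
    using that by (simp add: B_def if_distrib cong: if_cong)
  ultimately show ?case by (intro exI[of _ B]) simp
next
  case (Cons a as)
  define P where "P = (\<Prod>a\<leftarrow>as. [:-a, 1:])"
  from Cons obtain B where B1: "\<And>n. (\<Sum>j<n. (cmod (B j))\<^sup>2) \<le> 1"
    and B2: "\<And>q n. degree (P * q) < n \<Longrightarrow> (\<Sum>j<n. poly.coeff (P * q) j * cnj (B j)) = poly.coeff q 0"
    using Cons.IH[folded P_def] by auto
  define b where "b = 1 - a * cnj a"
  define y where "y = rec_nat 0 (\<lambda>j z. cnj a * z + B j)"
  have y: "y 0 = 0" "y (Suc j) = cnj a * y j + B j" for j by (simp_all add: y_def)
  define C where "C j = b * y j - a * B j" for j
  have "(\<Sum>j<n. (cmod (C j))\<^sup>2) \<le> 1" for n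
  proof -
    have "b = complex_of_real (1 - (cmod a)\<^sup>2)" unfolding b_def of_real_diff by (simp only: complex_norm_square of_real_1)
    moreover have "cmod a < 1" using Cons.prems by simp
    ultimately have b: "b * y n * cnj (y n) = complex_of_real ((1 - (cmod a)\<^sup>2) * (cmod (y n))\<^sup>2)"
      "0 \<le> 1 - (cmod a)\<^sup>2"
      by (simp_all add: complex_norm_square mult.assoc power_le_one del: of_real_power)
    have "complex_of_real ((1 - (cmod a)\<^sup>2) * (cmod (y n))\<^sup>2 + (\<Sum>j<n. (cmod (C j))\<^sup>2))
        = complex_of_real (\<Sum>j<n. (cmod (B j))\<^sup>2)"
      using blaschke_factor_isometry[of y a B y B n, OF y y, folded b_def] b(1)
      by (simp only: C_def of_real_add of_real_sum complex_norm_square)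
    then have "(1 - (cmod a)\<^sup>2) * (cmod (y n))\<^sup>2 + (\<Sum>j<n. (cmod (C j))\<^sup>2) = (\<Sum>j<n. (cmod (B j))\<^sup>2)"
      by (simp only: of_real_eq_iff)
    \<comment> \<open>The energy still held in the state is nonnegative because
      \<open>cmod a < 1\<close>, so the partial square sums of \<open>C\<close> are at most those of
      \<open>B\<close>.\<close>
    moreover have "0 \<le> (1 - (cmod a)\<^sup>2) * (cmod (y n))\<^sup>2" using b(2) by simp
    ultimately show ?thesis using B1[of n] by linarith
  qed
  moreover have "(\<Sum>j<n. poly.coeff ([:-a, 1:] * P * q) j * cnj (C j)) = poly.coeff q 0"
    if n: "degree ([:-a, 1:] * P * q) < n" for q n
  proof (cases "P * q = 0")
    case True
    then have "q = 0" by (auto simp: P_def prod_list_zero_iff)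
    then show ?thesis by simp
  next
    case False
    define r where "r = P * q"
    \<comment> \<open>For the input \<open>F = (1 - cnj a z) r\<close> the denominator of the factor
      cancels: the state is \<open>r\<close> delayed by one step, and the output is
      \<open>(z - a) r\<close>. The degree bound makes the final state \<open>x n\<close> zero, so
      the isometry has no boundary term.\<close>
    define x where "x n = (if n = 0 then 0 else poly.coeff r (n - 1))" for n
    define F where "F = P * ([:1, - cnj a:] * q)"
    have F: "F = [:1, - cnj a:] * r" unfolding F_def r_def by (simp only: mult_ac)
    have x: "x 0 = 0" "x (Suc j) = cnj a * x j + poly.coeff F j" for j
      by (cases j; simp add: x_def F coeff_pCons)+
    have G: "poly.coeff ([:-a, 1:] * P * q) j = b * x j - a * poly.coeff F j" for j
      unfolding mult.assoc r_def[symmetric]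
      by (cases j; simp add: x_def F b_def coeff_pCons algebra_simps)
    have "degree ([:-a, 1:] * r) = Suc (degree r)"
      using False by (subst degree_mult_eq) (auto simp: r_def)
    then have n': "Suc (degree r) < n" using n by (simp only: r_def mult.assoc)
    then have xn: "x n = 0" by (simp add: x_def coeff_eq_0)
    have "degree F \<le> Suc (degree r)"
      unfolding F by (rule order_trans[OF degree_mult_le]) simp
    then have "degree F < n" using n' by simp
    then have "(\<Sum>j<n. poly.coeff F j * cnj (B j)) = poly.coeff ([:1, - cnj a:] * q) 0"
      unfolding F_def by (intro B2)
    then show ?thesis
      using blaschke_factor_isometry[of x a "poly.coeff F" y B n, OF x y, folded b_def] xn
      by (simp only: G C_def) simp
  qed
  ultimately show ?case unfolding P_def by (intro exI[of _ C]) (simp add: mult.assoc)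
qed

lemma root_set_dvd:
  fixes g :: "complex poly"
  assumes "finite S" "\<And>a. a \<in> S \<Longrightarrow> poly g a = 0"
  shows "(\<Prod>a\<in>S. [:-a, 1:]) dvd g"
  using assms
proof (induction S arbitrary: g rule: finite_induct)
  case (insert a S)
  then obtain q where q: "g = [:-a, 1:] * q" by (meson dvdE insertI1 poly_eq_0_iff_dvd)
  have "poly q x = 0" if "x \<in> S" for x
    using insert.hyps(2) insert.prems[of x] that by (auto simp: q)
  then have "(\<Prod>a\<in>S. [:-a, 1:]) dvd q" by (rule insert.IH)
  then show ?case using insert.hyps unfolding q by (subst prod.insert) (auto intro: mult_dvd_mono simp del: mult_pCons_left)
qed simp

text \<open>A polynomial \<open>g\<close> vanishing on \<open>S\<close> is \<open>P q\<close> with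
  \<open>P\<close> the product of the \<open>X - a\<close>. The Blaschke functional returns
  \<open>q(0)\<close>, so \<open>P(0)\<close> times it returns \<open>g(0)\<close>. The modulus of
  \<open>P(0)\<close> is the product of the \<open>cmod a\<close>, whence the norm bound. Later
  \<open>g\<close> is the difference of two digit sequences with the same sum.\<close>

lemma ex_vanishing_functional:
  fixes S :: "complex set"
  assumes "finite S" "\<And>a. a \<in> S \<Longrightarrow> cmod a < 1"
  shows "\<exists>c :: nat \<Rightarrow> complex. (\<forall>n. (\<Sum>j<n. (cmod (c j))\<^sup>2) \<le> (\<Prod>a\<in>S. cmod a)\<^sup>2) \<and>
     (\<forall>g n. 0 < n \<and> (\<forall>a\<in>S. (\<Sum>j<n. g j * a ^ j) = 0) \<longrightarrow> (\<Sum>j<n. g j * c j) = g 0)"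
proof -
  obtain as where as: "set as = S" "distinct as" using finite_distinct_list[OF assms(1)] by blast
  define P where "P = (\<Prod>a\<in>S. [:-a, 1:])"
  have P: "P = (\<Prod>a\<leftarrow>as. [:-a, 1:])"
    using as by (simp add: P_def prod.distinct_set_conv_list[symmetric])
  obtain B where B1: "\<And>n. (\<Sum>j<n. (cmod (B j))\<^sup>2) \<le> 1"
    and B2: "\<And>q n. degree (P * q) < n \<Longrightarrow> (\<Sum>j<n. poly.coeff (P * q) j * cnj (B j)) = poly.coeff q 0"
    using ex_blaschke_functional[of as, folded P] assms(2) as(1) by auto
  define c where "c j = poly P 0 * cnj (B j)" for j
  have P0: "cmod (poly P 0) = (\<Prod>a\<in>S. cmod a)" unfolding P_def poly_prod prod_norm[symmetric] by simp
  have "(\<Sum>j<n. (cmod (c j))\<^sup>2) \<le> (\<Prod>a\<in>S. cmod a)\<^sup>2" for n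
  proof -
    have "(\<Sum>j<n. (cmod (c j))\<^sup>2) = (\<Prod>a\<in>S. cmod a)\<^sup>2 * (\<Sum>j<n. (cmod (B j))\<^sup>2)"
      by (simp add: c_def norm_mult P0 power_mult_distrib sum_distrib_left)
    also have "\<dots> \<le> (\<Prod>a\<in>S. cmod a)\<^sup>2 * 1" by (intro mult_left_mono B1) auto
    finally show ?thesis by simp
  qed
  moreover have "(\<Sum>j<n. g j * c j) = g 0" if n: "0 < n" and g: "\<And>a. a \<in> S \<Longrightarrow> (\<Sum>j<n. g j * a ^ j) = 0"
    for g n
  proof -
    define p where "p = (\<Sum>j<n. Polynomial.monom (g j) j)"
    have cp: "poly.coeff p k = (if k < n then g k else 0)" for k
      by (simp add: p_def coeff_sum)
    have "degree p \<le> n - 1"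
      by (rule degree_le) (use n in \<open>auto simp: cp\<close>)
    then have deg: "degree p < n" using n by linarith
    have "P dvd p"
      unfolding P_def using assms(1) g
      by (intro root_set_dvd) (auto simp: p_def poly_sum poly_monom)
    then obtain q where q: "p = P * q" by blast
    have "(\<Sum>j<n. g j * c j) = poly P 0 * (\<Sum>j<n. poly.coeff (P * q) j * cnj (B j))"
      by (simp add: c_def q[symmetric] cp sum_distrib_left mult.left_commute)
    also have "\<dots> = poly P 0 * poly.coeff q 0"
      using B2[of q n] deg q by simp
    also have "\<dots> = poly p 0" by (simp add: q flip: poly_0_coeff_0)
    also have "\<dots> = g 0" using n by (simp add: poly_0_coeff_0 cp)
    finally show ?thesis .
  qed
  ultimately show ?thesis by (intro exI[of _ c] conjI allI impI) simp_all
qed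

section \<open>Shannon entropy\<close>

lemma shannon_entropy_finite:
  assumes "finite (set_pmf p)"
  shows "shannon_entropy p = (\<Sum>x\<in>set_pmf p. pmf p x * - ln (pmf p x))"
proof -
  have "(\<Sum>\<^sub>\<infinity>x. pmf p x * ln (pmf p x)) = (\<Sum>\<^sub>\<infinity>x\<in>set_pmf p. pmf p x * ln (pmf p x))"
    by (intro infsum_cong_neutral) (auto simp: set_pmf_iff)
  then show ?thesis using assms by (simp add: shannon_entropy_def sum_negf)
qed

lemma expectation_finite:
  fixes f :: "'a \<Rightarrow> real"
  assumes "finite (set_pmf p)"
  shows "measure_pmf.expectation p f = (\<Sum>x\<in>set_pmf p. pmf p x * f x)"
  using integral_measure_pmf[OF assms, of p f] by simp

lemma shannon_entropy_eq_expectation: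
  assumes "finite (set_pmf p)"
  shows "shannon_entropy p = measure_pmf.expectation p (\<lambda>x. - ln (pmf p x))"
  by (simp only: shannon_entropy_finite[OF assms] expectation_finite[OF assms])

lemma shannon_entropy_nonneg:
  assumes "finite (set_pmf p)"
  shows "0 \<le> shannon_entropy p"
  unfolding shannon_entropy_finite[OF assms]
  by (intro sum_nonneg mult_nonneg_nonneg) (auto simp: pmf_le_1 pmf_positive ln_le_zero_iff)

lemma shannon_entropy_map_le:
  assumes "finite (set_pmf p)"
  shows "shannon_entropy (map_pmf f p) \<le> shannon_entropy p"
proof -
  have "shannon_entropy (map_pmf f p) = measure_pmf.expectation p (\<lambda>x. - ln (pmf (map_pmf f p) (f x)))"
    using assms by (simp add: shannon_entropy_eq_expectation)
  also have "\<dots> = (\<Sum>x\<in>set_pmf p. pmf p x * - ln (pmf (map_pmf f p) (f x)))"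
    by (rule expectation_finite[OF assms])
  also have "\<dots> \<le> (\<Sum>x\<in>set_pmf p. pmf p x * - ln (pmf p x))"
  proof (intro sum_mono mult_left_mono)
    fix x assume x: "x \<in> set_pmf p"
    have "pmf p x = measure_pmf.prob p {x}" by (simp add: measure_pmf_single)
    also have "\<dots> \<le> measure_pmf.prob p (f -` {f x})"
      by (intro measure_pmf.finite_measure_mono) auto
    finally have "pmf p x \<le> pmf (map_pmf f p) (f x)" by (simp add: pmf_map)
    with x show "- ln (pmf (map_pmf f p) (f x)) \<le> - ln (pmf p x)"
      by (simp add: pmf_positive)
  qed auto
  finally show ?thesis using assms by (simp add: shannon_entropy_finite)
qed

lemma shannon_entropy_map_inj:
  assumes "finite (set_pmf p)" "inj_on f (set_pmf p)"
  shows "shannon_entropy (map_pmf f p) = shannon_entropy p"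
proof (rule antisym)
  have "p = map_pmf (the_inv_into (set_pmf p) f) (map_pmf f p)"
    unfolding map_pmf_comp using assms(2)
    by (subst map_pmf_cong[OF refl, of p _ id]) (auto simp: the_inv_into_f_f)
  then show "shannon_entropy p \<le> shannon_entropy (map_pmf f p)"
    using shannon_entropy_map_le[of "map_pmf f p"] assms(1) by (metis finite_imageI set_map_pmf)
qed (use shannon_entropy_map_le assms in blast)

lemma shannon_entropy_pair:
  assumes "finite (set_pmf p)" "finite (set_pmf q)"
  shows "shannon_entropy (pair_pmf p q) = shannon_entropy p + shannon_entropy q"
proof -
  have "shannon_entropy (pair_pmf p q) =
      (\<Sum>x\<in>set_pmf p. \<Sum>y\<in>set_pmf q. pmf p x * pmf q y * (- ln (pmf p x) + - ln (pmf q y)))"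
    using assms unfolding sum.cartesian_product
    by (subst shannon_entropy_finite)
       (auto intro!: sum.cong simp: pmf_pair ln_mult_pos pmf_positive algebra_simps)
  also have "\<dots> = (\<Sum>x\<in>set_pmf p. pmf p x * - ln (pmf p x) * (\<Sum>y\<in>set_pmf q. pmf q y)
      + pmf p x * (\<Sum>y\<in>set_pmf q. pmf q y * - ln (pmf q y)))"
    by (intro sum.cong refl) (simp add: sum_distrib_left sum_subtractf sum_negf algebra_simps)
  finally show ?thesis
    using assms
    by (simp add: shannon_entropy_finite sum_pmf_eq_1 sum.distrib sum_subtractf sum_negf
        sum_distrib_right[symmetric])
qed

section \<open>The inequalities of Gibbs and Fano\<close>

text \<open>This is \<open>ln u \<le> u - 1\<close> at \<open>u = q x / pmf p x\<close>, averaged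
  over \<open>p\<close>. Total mass at most 1 is enough for \<open>q\<close>, which suits the
  weights in Fano's inequality.\<close>

lemma gibbs_inequality:
  fixes q :: "'a \<Rightarrow> real"
  assumes "finite (set_pmf p)" "\<And>x. x \<in> set_pmf p \<Longrightarrow> 0 < q x" "(\<Sum>x\<in>set_pmf p. q x) \<le> 1"
  shows "shannon_entropy p \<le> measure_pmf.expectation p (\<lambda>x. - ln (q x))"
proof -
  have "(\<Sum>x\<in>set_pmf p. pmf p x * (ln (q x) - ln (pmf p x))) \<le> (\<Sum>x\<in>set_pmf p. q x - pmf p x)"
  proof (rule sum_mono)
    fix x assume x: "x \<in> set_pmf p"
    then have "ln (q x) - ln (pmf p x) \<le> q x / pmf p x - 1"
      using assms(2) ln_le_minus_one[of "q x / pmf p x"] by (simp add: ln_div pmf_positive less_imp_neq[symmetric])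
    then have "pmf p x * (ln (q x) - ln (pmf p x)) \<le> pmf p x * (q x / pmf p x - 1)"
      by (intro mult_left_mono) auto
    also have "\<dots> = q x - pmf p x" using pmf_positive[OF x] by (simp add: field_simps)
    finally show "pmf p x * (ln (q x) - ln (pmf p x)) \<le> q x - pmf p x" .
  qed
  also have "\<dots> \<le> 0" using assms(1,3) by (simp add: sum_subtractf sum_pmf_eq_1)
  finally show ?thesis
    using assms(1) by (simp add: shannon_entropy_finite expectation_finite sum_subtractf algebra_simps sum_negf)
qed

text \<open>Gibbs' inequality against the true law of the second coordinate times a guessed
  conditional law of the first. The cost \<open>- ln (W x)\<close> is at most
  \<open>- ln (1 - \<delta>)\<close>, plus \<open>ln (card A / \<delta>)\<close> on the error
  event.\<close>

lemma fano_inequality: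
  fixes J :: "('a \<times> 'b) pmf" and d :: "'b \<Rightarrow> 'a"
  assumes fin: "finite (set_pmf J)" and A: "finite A" "fst ` set_pmf J \<subseteq> A"
    and \<delta>: "0 < \<delta>" "\<delta> < 1" and err: "measure_pmf.prob J {x. fst x \<noteq> d (snd x)} \<le> \<delta>"
  shows "shannon_entropy J \<le> shannon_entropy (map_pmf snd J) - ln (1 - \<delta>) + \<delta> * ln (real (card A) / \<delta>)"
proof -
  define P where "P = pmf (map_pmf snd J)"
  \<comment> \<open>The guess puts \<open>1 - \<delta>\<close> on the decoded value and
    \<open>\<delta> / card A\<close> on every other value. Its total over \<open>A\<close> is at
    most 1, whether or not the decoded value lies in \<open>A\<close>.\<close>
  define W where "W x = (if fst x = d (snd x) then 1 - \<delta> else \<delta> / real (card A))" for x :: "'a \<times> 'b"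
  have "A \<noteq> {}" using A(2) set_pmf_not_empty[of J] by auto
  then have cA: "1 \<le> card A" using A(1) by (simp add: Suc_leI card_gt_0_iff)
  have W: "0 < W x" for x using \<delta> cA by (simp add: W_def)
  have P: "0 < P (snd x)" if "x \<in> set_pmf J" for x
    unfolding P_def using that by (intro pmf_positive) auto
  let ?B = "snd ` set_pmf J"
  have "(\<Sum>x\<in>set_pmf J. P (snd x) * W x) \<le> (\<Sum>x\<in>A \<times> ?B. P (snd x) * W x)"
    using A fin by (intro sum_mono2) (auto simp: P_def W[THEN less_imp_le] subset_iff rev_image_eqI)
  also have "\<dots> = (\<Sum>b\<in>?B. \<Sum>a\<in>A. P b * W (a, b))"
    by (subst sum.swap) (simp add: sum.cartesian_product case_prod_unfold)
  also have "\<dots> \<le> (\<Sum>b\<in>?B. P b)"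
  proof (rule sum_mono)
    fix b assume "b \<in> ?B"
    have "(\<Sum>a\<in>A. W (a, b)) \<le> (\<Sum>a\<in>A. (if a = d b then 1 - \<delta> else 0) + \<delta> / real (card A))"
      using \<delta> by (intro sum_mono) (auto simp: W_def)
    also have "\<dots> \<le> 1" using A(1) cA \<delta> by (simp add: sum.distrib)
    finally have "P b * (\<Sum>a\<in>A. W (a, b)) \<le> P b * 1" by (intro mult_left_mono) (auto simp: P_def)
    then show "(\<Sum>a\<in>A. P b * W (a, b)) \<le> P b" by (simp add: sum_distrib_left)
  qed
  also have "\<dots> = 1" unfolding P_def using fin by (intro sum_pmf_eq_1) auto
  finally have "shannon_entropy J \<le> measure_pmf.expectation J (\<lambda>x. - ln (P (snd x) * W x))"
    using W P fin by (intro gibbs_inequality) auto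
  also have "\<dots> = measure_pmf.expectation J (\<lambda>x. - ln (P (snd x)) + - ln (W x))"
    using W P by (intro integral_cong_AE) (auto simp: AE_measure_pmf_iff ln_mult_pos)
  also have "\<dots> = measure_pmf.expectation J (\<lambda>x. - ln (P (snd x))) + measure_pmf.expectation J (\<lambda>x. - ln (W x))"
    using fin by (intro Bochner_Integration.integral_add integrable_measure_pmf_finite)
  also have "measure_pmf.expectation J (\<lambda>x. - ln (P (snd x))) = shannon_entropy (map_pmf snd J)"
    using fin by (simp add: shannon_entropy_eq_expectation P_def)
  also have "measure_pmf.expectation J (\<lambda>x. - ln (W x))
      \<le> measure_pmf.expectation J (\<lambda>x. - ln (1 - \<delta>) + ln (real (card A) / \<delta>) * indicator {x. fst x \<noteq> d (snd x)} x)"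
  proof (intro integral_mono integrable_measure_pmf_finite fin)
    fix x
    have "ln (1 - \<delta>) \<le> 0" using \<delta> by simp
    then show "- ln (W x) \<le> - ln (1 - \<delta>) + ln (real (card A) / \<delta>) * indicator {x. fst x \<noteq> d (snd x)} x"
      using \<delta> cA by (auto simp: W_def ln_div)
  qed
  also have "\<dots> = - ln (1 - \<delta>) + ln (real (card A) / \<delta>) * measure_pmf.prob J {x. fst x \<noteq> d (snd x)}"
    using fin by (subst Bochner_Integration.integral_add) (auto intro!: integrable_measure_pmf_finite)
  also have "\<dots> \<le> - ln (1 - \<delta>) + ln (real (card A) / \<delta>) * \<delta>"
    using err \<delta> cA by (intro add_left_mono mult_left_mono) auto
  finally show ?thesis by (simp add: mult.commute)
qed

section \<open>Conjugates and embeddings\<close>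

interpretation rat_complex: vector_space "\<lambda>(r::rat) (x::complex). of_rat r * x"
  by unfold_locales (auto simp: algebra_simps of_rat_add of_rat_mult)

definition additive_map :: "(complex \<Rightarrow> complex) \<Rightarrow> bool" where
  "additive_map \<mu> \<longleftrightarrow> (\<forall>x y. \<mu> (x + y) = \<mu> x + \<mu> y)"

lemma additive_map_add: "additive_map \<mu> \<Longrightarrow> \<mu> (x + y) = \<mu> x + \<mu> y"
  by (simp add: additive_map_def)

lemma additive_map_0: "additive_map \<mu> \<Longrightarrow> \<mu> 0 = 0"
  using additive_map_add[of \<mu> 0 0] by simp

lemma additive_map_diff: "additive_map \<mu> \<Longrightarrow> \<mu> (x - y) = \<mu> x - \<mu> y"
  using additive_map_add[of \<mu> "x - y" y] by simp

lemma additive_map_sum: "additive_map \<mu> \<Longrightarrow> \<mu> (\<Sum>i\<in>I. g i) = (\<Sum>i\<in>I. \<mu> (g i))"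
  by (induction I rule: infinite_finite_induct) (auto simp: additive_map_add additive_map_0)

lemma additive_map_of_int: "additive_map \<mu> \<Longrightarrow> \<mu> (of_int n * x) = of_int n * \<mu> x"
proof -
  assume \<mu>: "additive_map \<mu>"
  have nat: "\<mu> (of_nat k * x) = of_nat k * \<mu> x" for k
    by (induction k) (auto simp: algebra_simps additive_map_add[OF \<mu>] additive_map_0[OF \<mu>])
  show ?thesis
  proof (cases n rule: int_cases2)
    case (nonneg k)
    then show ?thesis by (simp add: nat)
  next
    case (nonpos k)
    then show ?thesis using additive_map_diff[OF \<mu>, of 0 "of_nat k * x"]
      by (simp add: nat additive_map_0[OF \<mu>])
  qed
qed

text \<open>\<open>\<mu>\<close> is the coordinate of \<open>v\<close> in a rational basis of the
  complex numbers that contains \<open>v\<close> and a basis of \<open>V\<close>.\<close>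

lemma ex_additive_map_separating:
  assumes "rat_complex.subspace V" "v \<notin> V"
  shows "\<exists>\<mu>. additive_map \<mu> \<and> (\<forall>x\<in>V. \<mu> x = 0) \<and> \<mu> v = 1"
proof -
  obtain B where B: "B \<subseteq> V" "rat_complex.independent B" "V \<subseteq> rat_complex.span B"
    using rat_complex.maximal_independent_subset by blast
  then have "rat_complex.span B = V" using assms(1) rat_complex.span_subspace by blast
  then have ind: "rat_complex.independent (insert v B)"
    using B assms(2) by (simp add: rat_complex.independent_insert)
  define C where "C = rat_complex.extend_basis (insert v B)"
  have C: "rat_complex.independent C" "rat_complex.span C = UNIV" "insert v B \<subseteq> C"
    unfolding C_def using ind rat_complex.extend_basis_superset[OF ind]
    by (auto simp: rat_complex.independent_extend_basis)
  define \<mu> :: "complex \<Rightarrow> complex" where "\<mu> x = of_rat (rat_complex.representation C x v)" for x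
  have "additive_map \<mu>"
    using C by (simp add: additive_map_def \<mu>_def rat_complex.representation_add of_rat_add)
  moreover have "\<mu> x = 0" if "x \<in> V" for x
  proof -
    have "rat_complex.representation C x = rat_complex.representation B x"
      using C B that by (intro rat_complex.representation_extend) auto
    moreover have "v \<notin> B" using B assms(2) by blast
    ultimately show ?thesis
      using rat_complex.representation_ne_zero[of B x v] by (auto simp: \<mu>_def)
  qed
  moreover have "\<mu> v = 1" using C by (simp add: \<mu>_def rat_complex.representation_basis)
  ultimately show ?thesis by blast
qed

text \<open>The action of \<open>q \<in> \<complex>[X]\<close> on maps \<open>\<mu>\<close> in which \<open>X\<close> acts as \<open>\<mu> \<mapsto> \<mu>(c \<sqdot>)\<close>.\<close>

definition poly_act :: "complex \<Rightarrow> complex poly \<Rightarrow> (complex \<Rightarrow> complex) \<Rightarrow> complex \<Rightarrow> complex" where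
  "poly_act c q \<mu> x = (\<Sum>k\<le>degree q. poly.coeff q k * \<mu> (c ^ k * x))"

lemma poly_act_altdef:
  assumes "degree q \<le> n"
  shows "poly_act c q \<mu> x = (\<Sum>k\<le>n. poly.coeff q k * \<mu> (c ^ k * x))"
  unfolding poly_act_def using assms
  by (intro sum.mono_neutral_left) (auto simp: coeff_eq_0)

lemma poly_act_linear_factor:
  "poly_act c ([:-\<rho>, 1:] * r) \<mu> x = poly_act c r \<mu> (c * x) - \<rho> * poly_act c r \<mu> x"
proof -
  define n where "n = degree r"
  have d: "degree ([:-\<rho>, 1:] * r) \<le> Suc n"
    unfolding n_def by (rule order_trans[OF degree_mult_le]) simp
  have coeff: "poly.coeff ([:-\<rho>, 1:] * r) k = (if k = 0 then 0 else poly.coeff r (k - 1)) - \<rho> * poly.coeff r k" for k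
    by (cases k) (auto simp: coeff_pCons)
  have "poly_act c ([:-\<rho>, 1:] * r) \<mu> x
      = (\<Sum>k\<le>Suc n. (if k = 0 then 0 else poly.coeff r (k - 1)) * \<mu> (c ^ k * x))
        - \<rho> * (\<Sum>k\<le>Suc n. poly.coeff r k * \<mu> (c ^ k * x))"
    by (simp only: poly_act_altdef[OF d] coeff left_diff_distrib sum_subtractf sum_distrib_left mult.assoc)
  also have "(\<Sum>k\<le>Suc n. (if k = 0 then 0 else poly.coeff r (k - 1)) * \<mu> (c ^ k * x))
      = (\<Sum>k\<le>n. poly.coeff r k * \<mu> (c ^ k * (c * x)))"
    by (subst sum.atMost_Suc_shift) (simp add: mult_ac)
  also have "\<dots> = poly_act c r \<mu> (c * x)" by (simp add: poly_act_def n_def)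
  also have "(\<Sum>k\<le>Suc n. poly.coeff r k * \<mu> (c ^ k * x)) = poly_act c r \<mu> x"
    by (rule poly_act_altdef[symmetric]) (simp add: n_def)
  finally show ?thesis .
qed

lemma additive_map_poly_act: "additive_map \<mu> \<Longrightarrow> additive_map (poly_act c q \<mu>)"
  by (simp add: additive_map_def poly_act_def distrib_left sum.distrib)

lemma poly_act_annihilates:
  assumes "additive_map \<mu>" "poly (of_int_poly q) c = 0"
  shows "poly_act c (of_int_poly q) \<mu> x = 0"
proof -
  have "poly_act c (of_int_poly q) \<mu> x = \<mu> (\<Sum>k\<le>degree q. of_int (poly.coeff q k) * (c ^ k * x))"
    by (simp add: poly_act_def additive_map_sum[OF assms(1)] additive_map_of_int[OF assms(1)])
  also have "(\<Sum>k\<le>degree q. of_int (poly.coeff q k) * (c ^ k * x)) = poly (of_int_poly q) c * x"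
    by (simp add: poly_altdef sum_distrib_right sum_distrib_left mult_ac)
  finally show ?thesis using assms by (simp add: additive_map_0)
qed

text \<open>Linear factors are split off \<open>q\<close> until the remaining quotient
  \<open>r\<close> no longer kills \<open>\<mu>\<close>; the factor removed last then makes
  \<open>poly_act c r \<mu>\<close> an eigenvector. This happens before degree 0 since
  \<open>\<mu>\<close> is nonzero. The explicit form of the eigenvector lets it inherit properties
  of \<open>\<mu>\<close>.\<close>

lemma ex_poly_act_eigen:
  assumes "q \<noteq> 0" "\<And>x. poly_act c q \<mu> x = 0" "\<mu> x0 \<noteq> 0"
  shows "\<exists>r \<rho>. poly q \<rho> = 0 \<and> (\<exists>x. poly_act c r \<mu> x \<noteq> 0) \<and>
           (\<forall>x. poly_act c r \<mu> (c * x) = \<rho> * poly_act c r \<mu> x)"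
  using assms(1,2)
proof (induction "degree q" arbitrary: q rule: less_induct)
  case less
  have "degree q \<noteq> 0"
  proof
    assume "degree q = 0"
    then obtain a where "q = [:a:]" by (meson degree_eq_zeroE)
    then show False using less.prems assms(3) by (auto simp: poly_act_def dest: spec[of _ x0])
  qed
  then obtain \<rho> where \<rho>: "poly q \<rho> = 0"
    using fundamental_theorem_of_algebra[of q] by (auto simp: constant_degree)
  then obtain r where r: "q = [:-\<rho>, 1:] * r" by (meson dvdE poly_eq_0_iff_dvd)
  with less.prems have "r \<noteq> 0" by auto
  show ?case
  proof (cases "\<exists>x. poly_act c r \<mu> x \<noteq> 0")
    case True
    moreover have "poly_act c r \<mu> (c * x) = \<rho> * poly_act c r \<mu> x" for x
      using less.prems(2)[of x] unfolding r poly_act_linear_factor by simp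
    ultimately show ?thesis using \<rho> by blast
  next
    case False
    have "degree q = Suc (degree r)" unfolding r using \<open>r \<noteq> 0\<close> by (subst degree_mult_eq) auto
    then have "\<exists>s \<sigma>. poly r \<sigma> = 0 \<and> (\<exists>x. poly_act c s \<mu> x \<noteq> 0) \<and>
           (\<forall>x. poly_act c s \<mu> (c * x) = \<sigma> * poly_act c s \<mu> x)"
      using False \<open>r \<noteq> 0\<close> by (intro less.hyps) auto
    then show ?thesis unfolding r by (metis mult_zero_right poly_mult)
  qed
qed

lemma is_min_int_poly_degree_pos:
  assumes "is_min_int_poly \<eta> f"
  shows "0 < degree f"
proof (rule ccontr)
  assume "\<not> 0 < degree f"
  then obtain a where "f = [:a:]" by (auto elim: degree_eq_zeroE)
  then show False using assms by (auto simp: is_min_int_poly_def)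
qed

text \<open>A nonzero additive \<open>\<mu>\<close> with \<open>\<mu> (\<eta> x) = z \<mu> x\<close> plays the role of a field embedding sending \<open>\<eta>\<close> to
  its conjugate \<open>z\<close>: it transports polynomial relations, and it can be refined to be an eigenvector of
  multiplication by further algebraic numbers without leaving the space of additive maps.\<close>

lemma ex_additive_map_conjugate:
  assumes f: "is_min_int_poly \<eta> f" and z: "poly (of_int_poly f) z = 0"
  shows "\<exists>\<mu>. additive_map \<mu> \<and> (\<exists>x. \<mu> x \<noteq> 0) \<and> (\<forall>x. \<mu> (\<eta> * x) = z * \<mu> x)"
proof -
  define d where "d = degree f - 1"
  have d: "degree f = Suc d" using is_min_int_poly_degree_pos[OF f] by (simp add: d_def)
  \<comment> \<open>\<open>V\<close> is the rational span of the powers of \<open>\<eta>\<close>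
    below \<open>d\<close>, written with a common denominator \<open>c\<close>. By minimality of
    \<open>degree f = Suc d\<close> it does not contain \<open>\<eta> ^ d\<close>.\<close>
  define V where "V = {x. \<exists>p c. (c::int) \<noteq> 0 \<and> (\<forall>k\<ge>d. poly.coeff p k = 0) \<and>
      of_int c * x = poly (of_int_poly p) \<eta>}"
  have "rat_complex.subspace V"
  proof (rule rat_complex.subspaceI)
    show "0 \<in> V" unfolding V_def by (intro CollectI exI[of _ "0::int poly"] exI[of _ "1::int"]) simp
  next
    fix x y assume "x \<in> V" "y \<in> V"
    then obtain p c q b where p: "c \<noteq> 0" "\<forall>k\<ge>d. poly.coeff p k = 0" "of_int c * x = poly (of_int_poly p) \<eta>"
      and q: "b \<noteq> 0" "\<forall>k\<ge>d. poly.coeff q k = 0" "of_int b * y = poly (of_int_poly q) \<eta>"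
      unfolding V_def by blast
    then show "x + y \<in> V" unfolding V_def
      by (intro CollectI exI[of _ "Polynomial.smult b p + Polynomial.smult c q"] exI[of _ "b * c"])
         (use p q in \<open>simp add: hom_distribs algebra_simps flip: p(3) q(3)\<close>)
  next
    fix r :: rat and x assume "x \<in> V"
    then obtain p c where p: "c \<noteq> 0" "\<forall>k\<ge>d. poly.coeff p k = 0" "of_int c * x = poly (of_int_poly p) \<eta>"
      unfolding V_def by blast
    obtain a b where ab: "r = of_int a / of_int b" "b \<noteq> 0"
      by (cases r rule: Rat_cases) (use that in \<open>simp add: Fract_of_int_quotient\<close>)
    show "of_rat r * x \<in> V" unfolding V_def
      by (intro CollectI exI[of _ "Polynomial.smult a p"] exI[of _ "b * c"])
         (use p ab in \<open>simp add: hom_distribs of_rat_divide flip: p(3)\<close>)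
  qed
  moreover have "\<eta> ^ d \<notin> V"
  proof
    assume "\<eta> ^ d \<in> V"
    then obtain p c where p: "c \<noteq> 0" "\<forall>k\<ge>d. poly.coeff p k = 0" "of_int c * \<eta> ^ d = poly (of_int_poly p) \<eta>"
      unfolding V_def by blast
    define g where "g = Polynomial.monom c d - p"
    have "poly.coeff g d \<noteq> 0" using p by (simp add: g_def)
    then have "g \<noteq> 0" by auto
    moreover have "poly (of_int_poly g) \<eta> = 0" using p(3) by (simp add: g_def hom_distribs poly_monom)
    moreover have "degree g \<le> d" using p(2) by (intro degree_le) (auto simp: g_def)
    ultimately show False using f d by (auto simp: is_min_int_poly_def)
  qed
  ultimately obtain \<phi> where l: "additive_map \<phi>" "\<And>x. x \<in> V \<Longrightarrow> \<phi> x = 0" "\<phi> (\<eta> ^ d) = 1"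
    using ex_additive_map_separating by blast
  \<comment> \<open>Since \<open>f\<close> annihilates \<open>\<phi>\<close>, the factor
    \<open>X - z\<close> annihilates \<open>poly_act \<eta> r \<phi>\<close>, so this is an
    eigenvector for the prescribed root \<open>z\<close>. It is nonzero: \<open>\<phi>\<close> kills
    the lower powers of \<open>\<eta>\<close>, so its value at 1 is the leading coefficient of
    \<open>r\<close>.\<close>
  obtain r where r: "of_int_poly f = [:-z, 1:] * r" using z by (meson dvdE poly_eq_0_iff_dvd)
  have f0: "f \<noteq> 0" using d by auto
  then have r0: "r \<noteq> 0" using r by auto
  have "Suc (degree r) = degree ([:-z, 1:] * r)" using r0 by (subst degree_mult_eq) auto
  then have dr: "degree r = d" using d unfolding r[symmetric] by simp
  have "poly_act \<eta> r \<phi> 1 = (\<Sum>k\<le>d. if k = d then poly.coeff r k else 0)"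
    unfolding poly_act_def dr
  proof (intro sum.cong refl)
    fix k assume "k \<in> {..d}"
    moreover have "\<phi> (\<eta> ^ k) = 0" if "k < d"
      using that unfolding V_def
      by (intro l(2)[unfolded V_def] CollectI exI[of _ "Polynomial.monom (1::int) k"] exI[of _ "1::int"])
         (simp add: poly_monom)
    ultimately show "poly.coeff r k * \<phi> (\<eta> ^ k * 1) = (if k = d then poly.coeff r k else 0)"
      using l(3) by (cases "k = d") auto
  qed
  then have "poly_act \<eta> r \<phi> 1 \<noteq> 0" using r0 dr by auto
  moreover have "poly_act \<eta> r \<phi> (\<eta> * x) = z * poly_act \<eta> r \<phi> x" for x
    using poly_act_annihilates[OF l(1), of f \<eta> x] f
    unfolding r poly_act_linear_factor is_min_int_poly_def by simp
  ultimately show ?thesis using additive_map_poly_act[OF l(1)] by blast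
qed

lemma ex_additive_map_mult_neq_0:
  assumes "additive_map \<mu>" "\<mu> x0 \<noteq> 0" "c \<noteq> 0"
  shows "\<exists>x. \<mu> (c * x) \<noteq> 0"
  using assms by (intro exI[of _ "x0 / c"]) simp

text \<open>The map \<open>\<mu>\<close> carries multiplication by \<open>f'(\<eta>)\<close> to
  multiplication by \<open>f'(z)\<close>. If \<open>f'(z) = 0\<close>, then
  \<open>f'(\<eta>) = 0\<close> because \<open>\<mu>\<close> is nonzero, against the minimality of
  the degree of \<open>f\<close>.\<close>

lemma conjugate_root_simple:
  assumes f: "is_min_int_poly \<eta> f" and z: "poly (of_int_poly f) z = 0"
  shows "poly (pderiv (of_int_poly f)) z \<noteq> (0::complex)"
proof
  assume 0: "poly (pderiv (of_int_poly f)) z = 0"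
  have pd: "pderiv (of_int_poly f :: complex poly) = of_int_poly (pderiv f)"
    by (simp add: of_int_hom.map_poly_pderiv)
  obtain \<mu> x0 where \<mu>: "additive_map \<mu>" "\<mu> x0 \<noteq> 0" "\<And>x. \<mu> (\<eta> * x) = z * \<mu> x"
    using ex_additive_map_conjugate[OF f z] by blast
  have pow: "\<mu> (\<eta> ^ k * x) = z ^ k * \<mu> x" for k x
    by (induction k) (simp_all add: \<mu>(3) mult.assoc)
  define w where "w = poly (of_int_poly (pderiv f)) \<eta>"
  have "\<mu> (w * x) = poly (of_int_poly (pderiv f)) z * \<mu> x" for x
    unfolding w_def
    by (simp add: poly_altdef sum_distrib_right additive_map_sum[OF \<mu>(1)] mult.assoc
        additive_map_of_int[OF \<mu>(1)] pow)
  then have "w = 0" using ex_additive_map_mult_neq_0[OF \<mu>(1,2), of w] 0 pd by auto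
  moreover have "pderiv f \<noteq> 0" using is_min_int_poly_degree_pos[OF f] by (simp add: pderiv_eq_0_iff)
  ultimately have "degree f \<le> degree (pderiv f)" using f by (auto simp: is_min_int_poly_def w_def)
  then show False using is_min_int_poly_degree_pos[OF f] by (simp add: degree_pderiv)
qed

text \<open>Induction on \<open>T\<close>: for a new \<open>s\<close>, replace \<open>\<mu>\<close>
  by an eigenvector \<open>poly_act s r \<mu>\<close>. Multiplications commute, so the eigenvalues
  for \<open>\<eta>\<close> and for the earlier elements survive.\<close>

lemma ex_simultaneous_eigen:
  assumes "finite T" "\<And>t. t \<in> T \<Longrightarrow> q t \<noteq> 0 \<and> poly (of_int_poly (q t)) t = 0"
    and \<mu>: "additive_map \<mu>" "\<exists>x. \<mu> x \<noteq> 0" "\<And>x. \<mu> (\<eta> * x) = z * \<mu> x"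
  shows "\<exists>\<mu> \<kappa>. additive_map \<mu> \<and> (\<exists>x. \<mu> x \<noteq> 0) \<and> (\<forall>x. \<mu> (\<eta> * x) = z * \<mu> x) \<and>
     (\<forall>t\<in>T. poly (of_int_poly (q t)) (\<kappa> t) = (0::complex) \<and> (\<forall>x. \<mu> (t * x) = \<kappa> t * \<mu> x))"
  using assms(1,2)
proof (induction T rule: finite_induct)
  case empty
  then show ?case using \<mu> by auto
next
  case (insert s T)
  from insert.prems have "\<exists>\<mu> \<kappa>. additive_map \<mu> \<and> (\<exists>x. \<mu> x \<noteq> 0) \<and> (\<forall>x. \<mu> (\<eta> * x) = z * \<mu> x) \<and>
     (\<forall>t\<in>T. poly (of_int_poly (q t)) (\<kappa> t) = (0::complex) \<and> (\<forall>x. \<mu> (t * x) = \<kappa> t * \<mu> x))"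
    by (intro insert.IH) simp_all
  then obtain \<mu> \<kappa> x0 where IH: "additive_map \<mu>" "\<mu> x0 \<noteq> 0" "\<And>x. \<mu> (\<eta> * x) = z * \<mu> x"
    "\<And>t. t \<in> T \<Longrightarrow> poly (of_int_poly (q t)) (\<kappa> t) = 0"
    "\<And>t x. t \<in> T \<Longrightarrow> \<mu> (t * x) = \<kappa> t * \<mu> x"
    by blast
  have "\<exists>r \<rho>. poly (of_int_poly (q s)) \<rho> = 0 \<and> (\<exists>x. poly_act s r \<mu> x \<noteq> 0) \<and>
           (\<forall>x. poly_act s r \<mu> (s * x) = \<rho> * poly_act s r \<mu> x)"
    using insert.prems[of s] IH(1,2) by (intro ex_poly_act_eigen poly_act_annihilates) auto
  then obtain r \<rho> where r: "poly (of_int_poly (q s)) \<rho> = 0" "\<exists>x. poly_act s r \<mu> x \<noteq> 0"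
    "\<And>x. poly_act s r \<mu> (s * x) = \<rho> * poly_act s r \<mu> x" by blast
  have comm: "poly_act s r \<mu> (c * x) = e * poly_act s r \<mu> x" if "\<And>x. \<mu> (c * x) = e * \<mu> x" for c e x
    unfolding poly_act_def by (simp add: that mult.left_commute[of _ c] sum_distrib_left mult_ac)
  show ?case
  proof (rule exI[of _ "poly_act s r \<mu>"], rule exI[of _ "\<kappa>(s := \<rho>)"], intro conjI ballI)
    show "\<forall>x. poly_act s r \<mu> (\<eta> * x) = z * poly_act s r \<mu> x" by (intro allI comm IH)
    fix t assume t: "t \<in> insert s T"
    then show "poly (of_int_poly (q t)) ((\<kappa>(s := \<rho>)) t) = 0" using r(1) IH(4) by auto
    show "\<forall>x. poly_act s r \<mu> (t * x) = (\<kappa>(s := \<rho>)) t * poly_act s r \<mu> x"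
    proof (cases "t = s")
      case False
      with t have "\<mu> (t * x) = \<kappa> t * \<mu> x" for x by (intro IH(5)) auto
      with False show ?thesis using comm by simp
    qed (use r(3) in simp)
  qed (use r(2) IH(1) additive_map_poly_act in blast)+
qed

text \<open>The eigenvalues \<open>\<kappa> t\<close> play the role of the images of the
  \<open>t\<close> under an embedding that sends \<open>\<eta>\<close> to \<open>z\<close>. Applying
  \<open>\<mu>\<close> to a multiple of a relation at \<open>\<eta>\<close> gives the relation at
  \<open>z\<close>. If \<open>\<kappa> s = \<kappa> t\<close>, then \<open>\<mu>\<close> kills all
  multiples of \<open>s - t\<close>, which forces \<open>s = t\<close>.\<close>

lemma ex_conjugate_relations:
  assumes T: "finite T" "\<And>t. t \<in> T \<Longrightarrow> q t \<noteq> 0 \<and> poly (of_int_poly (q t)) t = 0"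
    and f: "is_min_int_poly \<eta> f" and z: "poly (of_int_poly f) z = 0"
  shows "\<exists>\<kappa> \<in> PiE T (\<lambda>t. {x::complex. poly (of_int_poly (q t)) x = 0}). inj_on \<kappa> T \<and>
     (\<forall>n a b. a \<in> {..<n} \<rightarrow> T \<and> b \<in> {..<n} \<rightarrow> T \<and> (\<Sum>k<n. (a k - b k) * \<eta> ^ k) = 0
        \<longrightarrow> (\<Sum>k<n. (\<kappa> (a k) - \<kappa> (b k)) * z ^ k) = 0)"
proof -
  obtain \<mu>' where \<mu>': "additive_map \<mu>'" "\<exists>x. \<mu>' x \<noteq> 0" "\<And>x. \<mu>' (\<eta> * x) = z * \<mu>' x"
    using ex_additive_map_conjugate[OF f z] by blast
  obtain \<mu> \<kappa> x0 where \<mu>: "additive_map \<mu>" "\<mu> x0 \<noteq> 0" "\<And>x. \<mu> (\<eta> * x) = z * \<mu> x"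
    "\<And>t. t \<in> T \<Longrightarrow> poly (of_int_poly (q t)) (\<kappa> t) = 0"
    "\<And>t x. t \<in> T \<Longrightarrow> \<mu> (t * x) = \<kappa> t * \<mu> x"
    using ex_simultaneous_eigen[OF T \<mu>'] by blast
  have pow: "\<mu> (\<eta> ^ k * x) = z ^ k * \<mu> x" for k x
    by (induction k) (simp_all add: \<mu>(3) mult.assoc)
  have diff: "\<mu> ((s - t) * x) = (\<kappa> s - \<kappa> t) * \<mu> x" if "s \<in> T" "t \<in> T" for s t x
    using that by (simp add: left_diff_distrib additive_map_diff[OF \<mu>(1)] \<mu>(5))
  have "inj_on \<kappa> T"
  proof (rule inj_onI)
    fix s t assume st: "s \<in> T" "t \<in> T" "\<kappa> s = \<kappa> t"
    then have "\<mu> ((s - t) * x) = 0" for x using diff by simp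
    then show "s = t" using ex_additive_map_mult_neq_0[OF \<mu>(1,2), of "s - t"] by auto
  qed
  moreover have "(\<Sum>k<n. (\<kappa> (a k) - \<kappa> (b k)) * z ^ k) = 0"
    if ab: "a \<in> {..<n} \<rightarrow> T" "b \<in> {..<n} \<rightarrow> T" "(\<Sum>k<n. (a k - b k) * \<eta> ^ k) = 0" for n a b
  proof -
    have "(\<Sum>k<n. (\<kappa> (a k) - \<kappa> (b k)) * z ^ k) * \<mu> x0 = (\<Sum>k<n. \<mu> ((a k - b k) * (\<eta> ^ k * x0)))"
      unfolding sum_distrib_right using ab by (intro sum.cong) (auto simp: diff pow Pi_iff)
    also have "\<dots> = \<mu> ((\<Sum>k<n. (a k - b k) * \<eta> ^ k) * x0)"
      by (simp add: additive_map_sum[OF \<mu>(1), symmetric] sum_distrib_right sum_distrib_left mult_ac)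
    finally show ?thesis using ab(3) \<mu>(1,2) by (simp add: additive_map_0)
  qed
  \<comment> \<open>Restriction to \<open>T\<close> places \<open>\<kappa>\<close> in a finite set
    that does not depend on \<open>\<eta>\<close> or \<open>z\<close>, as the pigeonhole argument
    requires.\<close>
  ultimately show ?thesis
    using \<mu>(4) by (intro bexI[of _ "restrict \<kappa> T"]) (auto simp: Pi_iff inj_on_def cong: sum.cong_simp)
qed

section \<open>The minimal polynomial and its constant coefficient\<close>

text \<open>Pseudo-division and minimality of the degree give \<open>a g = f q\<close> for some
  nonzero integer \<open>a\<close>. By Gauss' lemma, \<open>f\<close> being primitive,
  \<open>a\<close> divides the content of \<open>q\<close> and can be cancelled.\<close>

lemma is_min_int_poly_dvd:
  assumes f: "is_min_int_poly \<eta> f" and g: "poly (of_int_poly g) \<eta> = 0"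
  shows "f dvd g"
proof -
  have f0: "f \<noteq> 0" using is_min_int_poly_degree_pos[OF f] by auto
  define r where "r = pseudo_mod g f"
  obtain a q where a: "a \<noteq> 0" "Polynomial.smult a g = f * q + r"
    using pseudo_mod(1)[OF f0, of g] unfolding r_def by blast
  have "poly (of_int_poly (Polynomial.smult a g)) \<eta> = poly (of_int_poly (f * q + r)) \<eta>"
    using a(2) by simp
  then have "poly (of_int_poly r) \<eta> = 0"
    using f g by (simp add: hom_distribs is_min_int_poly_def)
  then have "r = 0"
    using pseudo_mod(2)[OF f0, of g] f unfolding r_def[symmetric] is_min_int_poly_def
    by (meson leD)
  then have eq: "Polynomial.smult a g = f * q" using a(2) by simp
  have "content q = content (f * q)" using f by (simp add: content_mult is_min_int_poly_def)
  then have "a dvd content q" by (simp flip: eq)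
  then obtain q' where q': "q = [:a:] * q'" using const_poly_dvd_iff_dvd_content[of a q] by blast
  have "Polynomial.smult a g = Polynomial.smult a (f * q')" by (simp add: eq q')
  then have "g = f * q'" using a(1) by (simp add: smult_cancel)
  then show ?thesis by simp
qed

lemma distinct_roots_if_simple:
  fixes c :: complex
  assumes "p = Polynomial.smult c (\<Prod>a\<leftarrow>as. [:-a, 1:])"
    and "\<And>a. poly p a = 0 \<Longrightarrow> poly (pderiv p) a \<noteq> 0"
  shows "distinct as"
proof (rule ccontr)
  assume "\<not> distinct as"
  then obtain xs ys zs y where "as = xs @ [y] @ ys @ [y] @ zs" using not_distinct_decomp by blast
  then have "\<exists>r. p = [:-y, 1:] * ([:-y, 1:] * r)"
    unfolding assms(1)
    by (intro exI[of _ "Polynomial.smult c ((\<Prod>a\<leftarrow>xs. [:-a, 1:]) * (\<Prod>a\<leftarrow>ys. [:-a, 1:]) * (\<Prod>a\<leftarrow>zs. [:-a, 1:]))"])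
       (simp add: mult_ac del: mult_pCons_left mult_pCons_right)
  then obtain r where r: "p = [:-y, 1:] * ([:-y, 1:] * r)" by blast
  have "poly p y = 0" "poly (pderiv p) y = 0"
    unfolding r pderiv_mult by simp_all
  then show False using assms(2) by blast
qed

text \<open>Root by root, \<open>max 1 (cmod a)\<close> times the factor \<open>cmod a\<close>
  present only when \<open>cmod a < 1\<close> equals \<open>cmod a\<close>; the product of all roots
  is then read off from \<open>f(0)\<close>. Simplicity of the roots allows products over sets
  instead of lists.\<close>

lemma mahler_measure_times_small_roots:
  assumes f: "is_min_int_poly \<eta> f"
  defines "S \<equiv> {z. poly (of_int_poly f) z = (0::complex) \<and> cmod z < 1}"
  shows "finite S" "mahler_measure f * (\<Prod>z\<in>S. cmod z) = \<bar>real_of_int (poly.coeff f 0)\<bar>"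
proof -
  define p where "p = (of_int_poly f :: complex poly)"
  define as where "as = complex_roots_complex p"
  have p: "p = Polynomial.smult (lead_coeff p) (\<Prod>a\<leftarrow>as. [:-a, 1:])"
    unfolding as_def by (rule complex_roots(1)[symmetric])
  have p0: "p \<noteq> 0" using is_min_int_poly_degree_pos[OF f] by (auto simp: p_def)
  have dist: "distinct as"
    by (rule distinct_roots_if_simple[OF p]) (simp add: p_def conjugate_root_simple[OF f])
  have poly_p: "poly p x = lead_coeff p * (\<Prod>a\<in>set as. x - a)" for x
  proof -
    have "poly p x = lead_coeff p * (\<Prod>a\<leftarrow>as. x - a)"
      by (subst p) (simp add: poly_prod_list o_def)
    then show ?thesis using dist by (simp add: prod.distinct_set_conv_list)
  qed
  have roots: "poly p x = 0 \<longleftrightarrow> x \<in> set as" for x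
    using p0 by (auto simp: poly_p)
  have S: "S = {z \<in> set as. cmod z < 1}" by (auto simp: S_def roots[symmetric] p_def)
  then show "finite S" by simp
  have "mahler_measure f = cmod (lead_coeff p) * (\<Prod>a\<in>set as. max 1 (cmod a))"
    using dist by (simp add: mahler_measure_def mahler_measure_poly_def p_def[symmetric] as_def[symmetric]
        prod.distinct_set_conv_list)
  moreover have "(\<Prod>a\<in>set as. max 1 (cmod a)) * (\<Prod>z\<in>S. cmod z) = (\<Prod>a\<in>set as. cmod a)"
  proof -
    have "(\<Prod>z\<in>S. cmod z) = (\<Prod>a\<in>set as. if cmod a < 1 then cmod a else 1)"
      unfolding S by (simp add: prod.inter_filter)
    then show ?thesis by (simp flip: prod.distrib) (intro prod.cong refl, auto)
  qed
  ultimately have "mahler_measure f * (\<Prod>z\<in>S. cmod z) = cmod (lead_coeff p) * (\<Prod>a\<in>set as. cmod a)"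
    by (simp add: mult.assoc)
  also have "\<dots> = cmod (poly p 0)"
    unfolding poly_p norm_mult prod_norm[symmetric] by simp
  also have "poly p 0 = of_int (poly.coeff f 0)" by (simp add: p_def poly_0_coeff_0)
  finally show "mahler_measure f * (\<Prod>z\<in>S. cmod z) = \<bar>real_of_int (poly.coeff f 0)\<bar>" by simp
qed

section \<open>Integer matrices and a bound for the constant coefficient\<close>

lemma span_mult_closed:
  assumes "x \<in> rat_complex.span S" "\<And>s. s \<in> S \<Longrightarrow> c * s \<in> rat_complex.span S'"
  shows "c * x \<in> rat_complex.span S'"
  using assms(1)
proof (induction rule: rat_complex.span_induct_alt)
  case base
  then show ?case by (simp add: rat_complex.span_zero)
next
  case (step r s y)
  have "c * (of_rat r * s + y) = of_rat r * (c * s) + c * y" by (simp add: algebra_simps)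
  then show ?case
    using step assms(2) by (simp add: rat_complex.span_add rat_complex.span_scale)
qed

text \<open>The norm argument without a field extension: multiplication by the differences \<open>s - t\<close> on the
  \<open>\<rat>\<close>-algebra generated by \<open>T\<close> is given, up to a common denominator, by integer matrices, and the
  determinant of the resulting polynomial matrix is an integer polynomial that vanishes at \<open>\<eta>\<close>.\<close>

lemma ex_finite_spanning_stable:
  assumes "finite T" "\<And>t. t \<in> T \<Longrightarrow> q t \<noteq> 0 \<and> poly (of_int_poly (q t)) t = 0"
  shows "\<exists>S. finite S \<and> 1 \<in> S \<and> (\<forall>t\<in>T. \<forall>s\<in>S. t * s \<in> rat_complex.span S)"
  using assms
proof (induction T rule: finite_induct)
  case empty
  show ?case by (intro exI[of _ "{1}"]) auto
next
  case (insert u T)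
  from insert.prems have "\<exists>S. finite S \<and> 1 \<in> S \<and> (\<forall>t\<in>T. \<forall>s\<in>S. t * s \<in> rat_complex.span S)"
    by (intro insert.IH) simp_all
  then obtain S where S: "finite S" "1 \<in> S" "\<And>t s. t \<in> T \<Longrightarrow> s \<in> S \<Longrightarrow> t * s \<in> rat_complex.span S"
    by blast
  define d where "d = degree (q u)"
  have q: "q u \<noteq> 0" "poly (of_int_poly (q u)) u = 0" using insert.prems[of u] by simp_all
  have d0: "d \<noteq> 0"
  proof
    assume "d = 0"
    then obtain a where "q u = [:a:]" unfolding d_def by (meson degree_eq_zeroE)
    then show False using q by simp
  qed
  \<comment> \<open>The powers of \<open>u\<close> below the degree of \<open>q u\<close> suffice,
    since the relation \<open>q u\<close> expresses \<open>u ^ d\<close> rationally through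
    them.\<close>
  define S' where "S' = (\<lambda>(i, s). u ^ i * s) ` ({..<d} \<times> S)"
  have base: "u ^ i * s \<in> rat_complex.span S'" if "i < d" "s \<in> S" for i s
    using that unfolding S'_def by (intro rat_complex.span_base) force
  have top: "u ^ d * s \<in> rat_complex.span S'" if "s \<in> S" for s
  proof -
    define l where "l = lead_coeff (q u)"
    have l0: "l \<noteq> 0" using q by (simp add: l_def)
    have "(\<Sum>i\<le>d. of_int (poly.coeff (q u) i) * u ^ i) = 0"
      using q(2) by (simp add: poly_altdef d_def)
    then have "of_int l * u ^ d = - (\<Sum>i<d. of_int (poly.coeff (q u) i) * u ^ i)"
      by (simp add: lessThan_Suc_atMost[symmetric] l_def d_def eq_neg_iff_add_eq_0 add.commute)
    then have "u ^ d = - (\<Sum>i<d. of_int (poly.coeff (q u) i) * u ^ i) / of_int l"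
      using l0 by (simp add: field_simps)
    then have "u ^ d * s = (\<Sum>i<d. of_rat (- of_int (poly.coeff (q u) i) / of_int l) * (u ^ i * s))"
      by (simp add: of_rat_divide of_rat_minus sum_divide_distrib sum_distrib_right sum_negf mult.assoc)
    also have "\<dots> \<in> rat_complex.span S'"
      using base that by (intro rat_complex.span_sum rat_complex.span_scale) auto
    finally show ?thesis .
  qed
  have "t * s' \<in> rat_complex.span S'" if t: "t \<in> insert u T" and S': "s' \<in> S'" for t s'
  proof -
    obtain i s where s': "s' = u ^ i * s" "i < d" "s \<in> S" using S' by (auto simp: S'_def)
    show ?thesis
    proof (cases "t = u")
      case True
      then show ?thesis using s' base[of "Suc i" s] top[of s] by (cases "Suc i = d") (auto simp: mult_ac)
    next
      case False
      then have "t * s \<in> rat_complex.span S" using t S(3) s' by blast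
      then have "u ^ i * (t * s) \<in> rat_complex.span S'"
        by (rule span_mult_closed) (use base s' in auto)
      then show ?thesis by (simp add: s' mult_ac)
    qed
  qed
  moreover have "finite S'" using S by (simp add: S'_def)
  moreover have "1 \<in> S'" using S d0 by (force simp: S'_def intro!: image_eqI[of _ _ "(0, 1)"])
  ultimately show ?case by blast
qed

lemma ex_common_denominator:
  assumes "finite (F :: rat set)"
  shows "\<exists>N::int. N \<noteq> 0 \<and> (\<forall>r\<in>F. of_int N * r \<in> \<int>)"
  using assms
proof (induction F rule: finite_induct)
  case empty
  show ?case by (intro exI[of _ 1]) simp
next
  case (insert r F)
  then obtain N where N: "N \<noteq> 0" "\<And>r. r \<in> F \<Longrightarrow> of_int N * r \<in> \<int>" by blast
  obtain a b :: int where ab: "r = of_int a / of_int b" "b \<noteq> 0"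
    by (cases r rule: Rat_cases) (use that in \<open>simp add: Fract_of_int_quotient\<close>)
  have "of_int (N * b) * x \<in> \<int>" if x: "x \<in> insert r F" for x
  proof (cases "x = r")
    case True
    then have "of_int (N * b) * x = of_int (N * a)" using ab by simp
    then show ?thesis by (simp only: Ints_of_int)
  next
    case False
    then have "of_int N * x \<in> \<int>" using x N(2) by blast
    then have "of_int b * (of_int N * x) \<in> \<int>" by (rule Ints_mult[OF Ints_of_int])
    then show ?thesis by (simp add: mult_ac)
  qed
  then show ?case using N(1) ab(2) by (intro exI[of _ "N * b"]) auto
qed

text \<open>A basis inside the finite stable spanning set gives rational matrices for multiplication
  by the differences \<open>s - t\<close>. Only finitely many entries occur, so one denominator
  \<open>N\<close> clears them all.\<close>

lemma ex_integer_matrices: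
  assumes T: "finite T" "\<And>t. t \<in> T \<Longrightarrow> q t \<noteq> 0 \<and> poly (of_int_poly (q t)) t = 0"
  obtains r e and N :: int and Z
  where "0 < r" "inj_on e {..<r}" "rat_complex.independent (e ` {..<r})" "N \<noteq> 0"
    "\<And>s t i. s \<in> T \<Longrightarrow> t \<in> T \<Longrightarrow> i < r \<Longrightarrow>
      of_int N * ((s - t) * e i) = (\<Sum>j<(r::nat). of_int (Z (s - t) i j) * e j)"
proof -
  obtain S where S: "finite S" "1 \<in> S" "\<And>t s. t \<in> T \<Longrightarrow> s \<in> S \<Longrightarrow> t * s \<in> rat_complex.span S"
    using ex_finite_spanning_stable[OF T] by blast
  obtain B where B: "B \<subseteq> S" "rat_complex.independent B" "S \<subseteq> rat_complex.span B"
    using rat_complex.maximal_independent_subset by blast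
  have fB: "finite B" using B(1) S(1) finite_subset by blast
  have sp: "rat_complex.span S \<subseteq> rat_complex.span B"
    using B(3) rat_complex.span_minimal by blast
  define r where "r = card B"
  obtain e where e: "bij_betw e {..<r} B"
    using ex_bij_betw_nat_finite[OF fB] by (auto simp: r_def atLeast0LessThan)
  have "B \<noteq> {}" using B(3) S(2) by auto
  then have r0: "0 < r" using fB by (simp add: r_def card_gt_0_iff)
  define M where "M c i j = rat_complex.representation B (c * e i) (e j)" for c i j
  have eB: "e i \<in> B" if "i < r" for i using e that by (auto simp: bij_betw_def)
  have M: "(s - t) * e i = (\<Sum>j<r. of_rat (M (s - t) i j) * e j)" if st: "s \<in> T" "t \<in> T" and i: "i < r" for s t i
  proof -
    have "e i \<in> S" using eB[OF i] B(1) by blast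
    then have "s * e i \<in> rat_complex.span B" "t * e i \<in> rat_complex.span B"
      using S(3) st sp by (meson subsetD)+
    then have "(s - t) * e i \<in> rat_complex.span B"
      by (simp add: left_diff_distrib rat_complex.span_diff)
    then have "(s - t) * e i = (\<Sum>b\<in>B. of_rat (rat_complex.representation B ((s - t) * e i) b) * b)"
      using rat_complex.sum_representation_eq[OF B(2) _ fB] by simp
    also have "\<dots> = (\<Sum>j<r. of_rat (M (s - t) i j) * e j)"
      unfolding M_def by (rule sum.reindex_bij_betw[OF e, symmetric])
    finally show ?thesis .
  qed
  define F where "F = (\<lambda>(s, t, i, j). M (s - t) i j) ` (T \<times> T \<times> {..<r} \<times> {..<r})"
  have fF: "finite F" unfolding F_def by (intro finite_imageI finite_cartesian_product T(1) finite_lessThan)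
  obtain N :: int where N: "N \<noteq> 0" "\<And>x. x \<in> F \<Longrightarrow> of_int N * x \<in> \<int>"
    using ex_common_denominator[OF fF] by blast
  define Z where "Z c i j = \<lfloor>of_int N * M c i j\<rfloor>" for c i j
  have Z: "of_int (Z (s - t) i j) = of_int N * M (s - t) i j" if "s \<in> T" "t \<in> T" "i < r" "j < r" for s t i j
  proof -
    have "M (s - t) i j \<in> F" unfolding F_def using that by (intro image_eqI[of _ _ "(s, t, i, j)"]) auto
    from N(2)[OF this] obtain k where k: "of_int N * M (s - t) i j = of_int k" by (rule Ints_cases)
    show ?thesis unfolding Z_def k floor_of_int by (rule refl)
  qed
  have "of_int N * ((s - t) * e i) = (\<Sum>j<r. of_int (Z (s - t) i j) * e j)"
    if st: "s \<in> T" "t \<in> T" "i < r" for s t i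
  proof -
    have "(of_int (Z (s - t) i j) :: complex) = of_int N * of_rat (M (s - t) i j)" if "j < r" for j
      using arg_cong[OF Z[OF st that], of of_rat] by (simp add: of_rat_mult)
    then show ?thesis by (simp add: M[OF st] sum_distrib_left mult.assoc)
  qed
  moreover have "inj_on e {..<r}" "e ` {..<r} = B" using e by (auto simp: bij_betw_def)
  ultimately show ?thesis using r0 N(1) B(2) by (intro that[of r e N Z]) auto
qed

text \<open>Put the matrices of the coefficients \<open>a k - b k\<close> into one polynomial matrix
  \<open>A\<close>. The vector of basis elements lies in the kernel of \<open>A\<close> at
  \<open>\<eta>\<close>, so \<open>f\<close> divides \<open>det A\<close>. At \<open>X = 0\<close>
  the constant coefficient of \<open>f\<close> divides the nonzero determinant of
  \<open>Y (a 0 - b 0)\<close>, one of finitely many integers fixed by \<open>T\<close>.\<close>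

lemma ex_constant_coeff_bound:
  assumes T: "finite T" "\<And>t. t \<in> T \<Longrightarrow> q t \<noteq> 0 \<and> poly (of_int_poly (q t)) t = 0"
  shows "\<exists>C::int. \<forall>\<eta> f n a b. is_min_int_poly \<eta> f \<and> 0 < n \<and> a \<in> {..<n} \<rightarrow> T \<and> b \<in> {..<n} \<rightarrow> T \<and>
     (\<Sum>k<n. (a k - b k) * \<eta> ^ k) = 0 \<and> a 0 \<noteq> b 0 \<longrightarrow> \<bar>poly.coeff f 0\<bar> \<le> C"
proof -
  obtain r :: nat and e and N :: int and Z where r: "0 < r" and e: "inj_on e {..<r}" "rat_complex.independent (e ` {..<r})"
    and N: "N \<noteq> 0"
    and Z: "\<And>s t i. s \<in> T \<Longrightarrow> t \<in> T \<Longrightarrow> i < r \<Longrightarrow>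
      of_int N * ((s - t) * e i) = (\<Sum>j<r. of_int (Z (s - t) i j) * e j)"
    using ex_integer_matrices[OF T] by blast
  have indep: "v i = 0" if "(\<Sum>i<r. of_int (v i) * e i) = 0" "i < r" for v :: "nat \<Rightarrow> int" and i
  proof -
    define u where "u b = (of_int (v (inv_into {..<r} e b)) :: rat)" for b
    have "(\<Sum>b\<in>e ` {..<r}. of_rat (u b) * b) = (\<Sum>i<r. of_int (v i) * e i)"
      using e(1) by (simp add: sum.reindex u_def inv_into_f_f)
    then have "u (e i) = 0"
      using rat_complex.independentD[OF e(2) _ subset_refl, of u "e i"] that by auto
    then show ?thesis using e(1) that(2) by (simp add: u_def inv_into_f_f)
  qed
  define Y where "Y c = Matrix.mat r r (\<lambda>(i, j). Z c i j)" for c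
  have Y: "Y c \<in> carrier_mat r r" for c by (simp add: Y_def)
  \<comment> \<open>A left kernel vector \<open>v\<close> would give
    \<open>N (s - t) \<Sum> v i e i = 0\<close>, hence an integer relation between the basis
    elements.\<close>
  have det_Y: "Determinant.det (Y (s - t)) \<noteq> 0" if st: "s \<in> T" "t \<in> T" "s \<noteq> t" for s t
  proof
    assume "Determinant.det (Y (s - t)) = 0"
    then have "Determinant.det (transpose_mat (Y (s - t))) = 0" using det_transpose[OF Y] by simp
    then obtain v where v: "v \<in> carrier_vec r" "v \<noteq> 0\<^sub>v r" "transpose_mat (Y (s - t)) *\<^sub>v v = 0\<^sub>v r"
      using det_0_iff_vec_prod_zero[of "transpose_mat (Y (s - t))" r] Y by auto
    have v0: "(\<Sum>i<r. Z (s - t) i j * vec_index v i) = 0" if "j < r" for j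
    proof -
      have "vec_index (transpose_mat (Y (s - t)) *\<^sub>v v) j = 0" using v(3) that by simp
      then show ?thesis using v(1) that
        by (simp add: Y_def scalar_prod_def atLeast0LessThan cong: sum.cong_simp)
    qed
    have "of_int N * (s - t) * (\<Sum>i<r. of_int (vec_index v i) * e i)
        = (\<Sum>i<r. of_int (vec_index v i) * (of_int N * ((s - t) * e i)))"
      by (simp add: sum_distrib_left mult_ac)
    also have "\<dots> = (\<Sum>i<r. \<Sum>j<r. of_int (vec_index v i) * (of_int (Z (s - t) i j) * e j))"
      using st Z by (simp add: sum_distrib_left)
    also have "\<dots> = (\<Sum>j<r. of_int (\<Sum>i<r. Z (s - t) i j * vec_index v i) * e j)"
      by (subst sum.swap) (simp add: sum_distrib_left sum_distrib_right mult_ac)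
    also have "\<dots> = 0" using v0 by simp
    finally have "(\<Sum>i<r. of_int (vec_index v i) * e i) = 0" using N st by simp
    then have "vec_index v i = 0" if "i < r" for i using indep that by blast
    then have "v = 0\<^sub>v r" using v(1) by (intro eq_vecI) auto
    then show False using v(2) by blast
  qed
  define C where "C = (\<Sum>c\<in>(\<lambda>(s, t). s - t) ` (T \<times> T). \<bar>Determinant.det (Y c)\<bar>)"
  have "\<bar>poly.coeff f 0\<bar> \<le> C"
    if f: "is_min_int_poly \<eta> f" and n: "0 < n" and ab: "a \<in> {..<n} \<rightarrow> T" "b \<in> {..<n} \<rightarrow> T"
      and rel: "(\<Sum>k<n. (a k - b k) * \<eta> ^ k) = 0" and ne: "a 0 \<noteq> b 0" for \<eta> f n a b
  proof -
    have abT: "a k \<in> T" "b k \<in> T" if "k < n" for k using ab that by auto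
    define A where "A = Matrix.mat r r (\<lambda>(i, j). \<Sum>k<n. Polynomial.monom (Z (a k - b k) i j) k)"
    have A: "A \<in> carrier_mat r r" by (simp add: A_def)
    interpret h: comm_ring_hom "\<lambda>p::int poly. poly (of_int_poly p :: complex poly) \<eta>"
      by unfold_locales (auto simp: hom_distribs)
    define w where "w = Matrix.vec r e"
    have e0: "e 0 \<noteq> 0"
      using e(2) r rat_complex.dependent_zero[of "e ` {..<r}"] by (metis imageI lessThan_iff)
    have "w \<noteq> 0\<^sub>v r"
    proof
      assume "w = 0\<^sub>v r"
      then have "vec_index w 0 = 0" using r by simp
      then show False using e0 r by (simp add: w_def)
    qed
    moreover have "map_mat (\<lambda>p. poly (of_int_poly p) \<eta>) A *\<^sub>v w = 0\<^sub>v r"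
    proof (rule eq_vecI)
      fix i assume "i < dim_vec (0\<^sub>v r :: complex Matrix.vec)"
      then have i: "i < r" by simp
      have "vec_index (map_mat (\<lambda>p. poly (of_int_poly p) \<eta>) A *\<^sub>v w) i
          = (\<Sum>j<r. (\<Sum>k<n. of_int (Z (a k - b k) i j) * \<eta> ^ k) * e j)"
        using i by (simp add: A_def w_def scalar_prod_def atLeast0LessThan h.hom_sum poly_monom
            cong: sum.cong_simp)
      also have "\<dots> = (\<Sum>k<n. \<eta> ^ k * (\<Sum>j<r. of_int (Z (a k - b k) i j) * e j))"
        by (simp add: sum_distrib_left sum_distrib_right mult_ac) (rule sum.swap)
      also have "\<dots> = (\<Sum>k<n. \<eta> ^ k * (of_int N * ((a k - b k) * e i)))"
        using abT i by (simp add: Z)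
      also have "\<dots> = of_int N * e i * (\<Sum>k<n. (a k - b k) * \<eta> ^ k)"
        by (simp add: sum_distrib_left mult_ac)
      finally show "vec_index (map_mat (\<lambda>p. poly (of_int_poly p) \<eta>) A *\<^sub>v w) i = vec_index (0\<^sub>v r) i"
        using rel i by simp
    qed (simp add: A_def)
    moreover have "w \<in> carrier_vec r" by (simp add: w_def)
    ultimately have "Determinant.det (map_mat (\<lambda>p. poly (of_int_poly p) \<eta>) A) = 0"
      using A det_0_iff_vec_prod_zero_field[of "map_mat (\<lambda>p. poly (of_int_poly p) \<eta>) A" r] by auto
    then have "poly (of_int_poly (Determinant.det A)) \<eta> = 0" by (simp add: h.hom_det)
    then have "f dvd Determinant.det A" by (rule is_min_int_poly_dvd[OF f])
    then have "poly f 0 dvd poly (Determinant.det A) 0" by (metis dvdE dvd_triv_left poly_mult)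
    also have "poly (Determinant.det A) 0 = Determinant.det (map_mat (\<lambda>p. poly p 0) A)"
      by (rule comm_ring_hom.hom_det[OF poly_hom.comm_ring_hom_axioms, symmetric])
    also have "map_mat (\<lambda>p. poly p 0) A = Y (a 0 - b 0)"
      using n by (intro eq_matI) (auto simp: A_def Y_def poly_sum poly_monom power_0_left if_distrib cong: if_cong)
    finally have "poly.coeff f 0 dvd Determinant.det (Y (a 0 - b 0))" by (simp add: poly_0_coeff_0)
    then have "\<bar>poly.coeff f 0\<bar> \<le> \<bar>Determinant.det (Y (a 0 - b 0))\<bar>"
      using det_Y[OF abT[OF n] ne] dvd_imp_le_int by blast
    also have "\<dots> \<le> C"
      unfolding C_def using T abT[OF n] by (intro member_le_sum) auto
    finally show ?thesis .
  qed
  then show ?thesis by blast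
qed

section \<open>Independent sums\<close>

text \<open>Fekete's lemma: division of \<open>n\<close> by \<open>k\<close> with remainder compares
  \<open>u n / n\<close> with \<open>u k / k\<close> up to a bounded remainder term. It ensures that
  the \<open>lim\<close> in \<open>garsia_entropy\<close> is a genuine limit.\<close>

lemma subadditive_average_convergent:
  fixes u :: "nat \<Rightarrow> real"
  assumes sub: "\<And>m n. u (m + n) \<le> u m + u n" and nonneg: "\<And>n. 0 \<le> u n"
  shows "convergent (\<lambda>n. u n / real n)"
proof -
  define L where "L = (INF n\<in>{1..}. u n / real n)"
  have bdd: "bdd_below ((\<lambda>n. u n / real n) ` {1..})"
    using nonneg by (intro bdd_belowI[of _ 0]) auto
  have mult: "u (k * q + r) \<le> real q * u k + u r" for k q r
  proof (induction q)
    case (Suc q)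
    have "u (k * Suc q + r) = u (k + (k * q + r))" by (simp add: algebra_simps)
    also have "\<dots> \<le> u k + (real q * u k + u r)" using sub[of k "k * q + r"] Suc by linarith
    finally show ?case by (simp add: algebra_simps)
  qed simp
  have "(\<lambda>n. u n / real n) \<longlonglongrightarrow> L"
  proof (rule LIMSEQ_I)
    fix e :: real assume e: "0 < e"
    have "(INF n\<in>{1..}. u n / real n) < L + e / 2" using e by (simp add: L_def)
    then obtain k where k: "1 \<le> k" "u k / real k < L + e / 2"
      using cINF_less_iff[OF _ bdd, of "L + e / 2"] by auto
    define M where "M = (\<Sum>r<k. u r)"
    have M0: "0 \<le> M" unfolding M_def by (intro sum_nonneg nonneg)
    obtain n0 :: nat where n0: "2 * M / e < real n0" using reals_Archimedean2 by blast
    have "norm (u n / real n - L) < e" if n: "max 1 n0 \<le> n" for n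
    proof -
      have n': "0 < real n" "real n0 \<le> real n" using n by auto
      have "u n \<le> real (n div k) * u k + u (n mod k)" using mult[of k "n div k" "n mod k"] by simp
      also have "u (n mod k) \<le> M"
        unfolding M_def using k(1) nonneg by (intro member_le_sum) auto
      also have "real (n div k) * u k \<le> real n / real k * u k"
        by (intro mult_right_mono nonneg of_nat_div_le_of_nat)
      finally have "u n / real n \<le> (real n / real k * u k + M) / real n"
        by (intro divide_right_mono) auto
      also have "\<dots> = u k / real k + M / real n" using n' by (simp add: field_simps)
      also have "M / real n < e / 2"
      proof -
        have "2 * M / e < real n" using n0 n' by linarith
        then show ?thesis using e n' by (simp add: field_simps)
      qed
      finally have "u n / real n < L + e" using k(2) by linarith
      moreover have "L \<le> u n / real n" unfolding L_def using n by (intro cINF_lower bdd) auto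
      ultimately show ?thesis by simp
    qed
    then show "\<exists>no. \<forall>n\<ge>no. norm (u n / real n - L) < e" by blast
  qed
  then show ?thesis by (rule convergentI)
qed

lemma Pi_pmf_lessThan_add:
  fixes m n :: nat
  shows "Pi_pmf {..<m + n} d (\<lambda>_. p) =
     map_pmf (\<lambda>(f, g) i. if i < m then f i else g (i - m))
       (pair_pmf (Pi_pmf {..<m} d (\<lambda>_. p)) (Pi_pmf {..<n} d (\<lambda>_. p)))"
proof -
  have un: "{..<m + n} = {..<m} \<union> {m..<m + n}" by auto
  have shift: "Pi_pmf {m..<m + n} d (\<lambda>_. p) =
      map_pmf (\<lambda>g i. if m \<le> i then g (i - m) else d) (Pi_pmf {..<n} d (\<lambda>_. p))"
  proof -
    \<comment> \<open>Indices below \<open>m\<close> are sent to \<open>n\<close>, which lies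
      outside \<open>{..<n}\<close>, so \<open>g\<close> has the default value \<open>d\<close>
      there.\<close>
    define h where "h i = (if i < m then n else i - m)" for i
    have "Pi_pmf {m..<m + n} d (\<lambda>_. p) = map_pmf (\<lambda>g. g \<circ> h) (Pi_pmf {..<n} d (\<lambda>_. p))"
      by (intro Pi_pmf_bij_betw bij_betwI[of _ _ _ "\<lambda>i. i + m"]) (auto simp: h_def)
    also have "\<dots> = map_pmf (\<lambda>g i. if m \<le> i then g (i - m) else d) (Pi_pmf {..<n} d (\<lambda>_. p))"
    proof (intro map_pmf_cong refl ext)
      fix g i assume "g \<in> set_pmf (Pi_pmf {..<n} d (\<lambda>_. p))"
      then have "g n = d" using set_Pi_pmf_subset[of "{..<n}" d] by fastforce
      then show "(g \<circ> h) i = (if m \<le> i then g (i - m) else d)" by (auto simp: h_def)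
    qed
    finally show ?thesis .
  qed
  show ?thesis
    unfolding un by (subst Pi_pmf_union) (auto simp: shift pair_map_pmf2 map_pmf_comp case_prod_unfold
        intro!: map_pmf_cong)
qed

definition power_sum :: "complex \<Rightarrow> nat \<Rightarrow> (nat \<Rightarrow> real) \<Rightarrow> complex" where
  "power_sum \<eta> n \<xi> = (\<Sum>j<n. complex_of_real (\<xi> j) * \<eta> ^ j)"

lemma garsia_sum_eq: "garsia_sum \<eta> \<nu> n = map_pmf (power_sum \<eta> n) (Pi_pmf {..<n} 0 (\<lambda>_. \<nu>))"
  by (simp add: garsia_sum_def power_sum_def[abs_def])

lemma power_sum_append:
  "power_sum \<eta> (m + n) (\<lambda>i. if i < m then f i else g (i - m)) = power_sum \<eta> m f + \<eta> ^ m * power_sum \<eta> n g"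
proof -
  have split: "(\<Sum>j<m + n. F j) = (\<Sum>j<m. F j) + (\<Sum>j<n. F (m + j))" for F :: "nat \<Rightarrow> complex"
    by (induction n) (auto simp: add.assoc)
  have "power_sum \<eta> (m + n) (\<lambda>i. if i < m then f i else g (i - m))
      = (\<Sum>j<m. complex_of_real (f j) * \<eta> ^ j)
        + (\<Sum>j<n. complex_of_real (g j) * \<eta> ^ (m + j))"
    unfolding power_sum_def split by simp
  then show ?thesis by (simp add: power_sum_def sum_distrib_left power_add mult_ac)
qed

lemma finite_set_Pi_pmf_const:
  assumes "finite A" "finite (set_pmf p)"
  shows "finite (set_pmf (Pi_pmf A d (\<lambda>_. p)))"
  using assms by (simp add: set_Pi_pmf finite_PiE_dflt)

lemma finite_set_garsia_sum: "finite (set_pmf \<nu>) \<Longrightarrow> finite (set_pmf (garsia_sum \<eta> \<nu> n))"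
  by (simp add: garsia_sum_eq finite_set_Pi_pmf_const)

lemma garsia_sum_add:
  "garsia_sum \<eta> \<nu> (m + n) =
     map_pmf (\<lambda>(x, y). x + \<eta> ^ m * y) (pair_pmf (garsia_sum \<eta> \<nu> m) (garsia_sum \<eta> \<nu> n))"
  unfolding garsia_sum_eq Pi_pmf_lessThan_add map_pair[symmetric]
  by (simp add: map_pmf_comp case_prod_unfold power_sum_append)

lemma shannon_entropy_garsia_sum_add_le:
  assumes "finite (set_pmf \<nu>)"
  shows "shannon_entropy (garsia_sum \<eta> \<nu> (m + n))
     \<le> shannon_entropy (garsia_sum \<eta> \<nu> m) + shannon_entropy (garsia_sum \<eta> \<nu> n)"
  unfolding garsia_sum_add
  using shannon_entropy_map_le[of "pair_pmf (garsia_sum \<eta> \<nu> m) (garsia_sum \<eta> \<nu> n)"]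
  by (simp add: assms finite_set_garsia_sum shannon_entropy_pair)

lemma garsia_entropy_ge:
  assumes fin: "finite (set_pmf \<nu>)"
    and step: "\<And>n. shannon_entropy (garsia_sum \<eta> \<nu> n) + h \<le> shannon_entropy (garsia_sum \<eta> \<nu> (Suc n))"
  shows "h \<le> garsia_entropy \<eta> \<nu>"
proof -
  define u where "u n = shannon_entropy (garsia_sum \<eta> \<nu> n)" for n
  have nonneg: "0 \<le> u n" for n
    unfolding u_def by (intro shannon_entropy_nonneg finite_set_garsia_sum fin)
  have "convergent (\<lambda>n. u n / real n)"
    using shannon_entropy_garsia_sum_add_le[OF fin] nonneg
    by (intro subadditive_average_convergent) (simp_all add: u_def)
  then have lim: "(\<lambda>n. u n / real n) \<longlonglongrightarrow> garsia_entropy \<eta> \<nu>"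
    unfolding garsia_entropy_def u_def[symmetric] by (simp add: convergent_LIMSEQ_iff)
  have "real n * h \<le> u n" for n
  proof (induction n)
    case 0
    then show ?case using nonneg[of 0] by simp
  next
    case (Suc n)
    then show ?case using step[of n] by (simp add: u_def algebra_simps)
  qed
  then have "h \<le> u n / real n" if "1 \<le> n" for n using that by (simp add: field_simps)
  then show ?thesis by (intro LIMSEQ_le_const[OF lim]) blast
qed

text \<open>The sum of length \<open>n + 1\<close> is the first digit plus \<open>\<eta>\<close>
  times an independent sum of length \<open>n\<close>: this is the concatenation of families of
  lengths 1 and \<open>n\<close>.\<close>

lemma map_pmf_first_and_sum:
  "map_pmf (\<lambda>\<xi>. (\<xi> 0, power_sum \<eta> (Suc n) \<xi>)) (Pi_pmf {..<Suc n} 0 (\<lambda>_. \<nu>)) =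
     map_pmf (\<lambda>(x, y). (x, complex_of_real x + \<eta> * y)) (pair_pmf \<nu> (garsia_sum \<eta> \<nu> n))"
proof -
  have 1: "map_pmf (\<lambda>f. f 0) (Pi_pmf {..<1::nat} 0 (\<lambda>_. \<nu>)) = \<nu>"
    by (subst Pi_pmf_component) auto
  have 2: "power_sum \<eta> 1 f = complex_of_real (f 0)" for f by (simp add: power_sum_def)
  have "map_pmf (\<lambda>\<xi>. (\<xi> 0, power_sum \<eta> (1 + n) \<xi>)) (Pi_pmf {..<1 + n} 0 (\<lambda>_. \<nu>)) =
     map_pmf (\<lambda>(x, y). (x, complex_of_real x + \<eta> * y))
       (pair_pmf (map_pmf (\<lambda>f. f 0) (Pi_pmf {..<1::nat} 0 (\<lambda>_. \<nu>))) (garsia_sum \<eta> \<nu> n))"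
    unfolding garsia_sum_eq Pi_pmf_lessThan_add map_pair[symmetric] map_pmf_comp case_prod_unfold
      power_sum_append 2 by simp
  then show ?thesis unfolding 1 by simp
qed

text \<open>As \<open>\<eta> \<noteq> 0\<close>, the pair of first digit and sum is an injective
  image of the independent pair of first digit and shorter sum, so its entropy is the sum of the two
  entropies. Fano's inequality bounds the same entropy by that of the longer sum plus the decoding
  loss.\<close>

lemma shannon_entropy_garsia_sum_Suc_ge:
  fixes \<nu> :: "real pmf"
  assumes fin: "finite (set_pmf \<nu>)" and "\<eta> \<noteq> 0" and \<delta>: "0 < \<delta>" "\<delta> < 1"
    and G: "measure_pmf.prob (Pi_pmf {..<Suc n} 0 (\<lambda>_. \<nu>)) (- G) \<le> \<delta>"
    and dec: "\<And>\<xi> \<xi>'. \<xi> \<in> G \<Longrightarrow> \<xi>' \<in> G \<Longrightarrow> \<xi> ` {..<Suc n} \<subseteq> set_pmf \<nu> \<Longrightarrow> \<xi>' ` {..<Suc n} \<subseteq> set_pmf \<nu> \<Longrightarrow>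
      power_sum \<eta> (Suc n) \<xi> = power_sum \<eta> (Suc n) \<xi>' \<Longrightarrow> \<xi> 0 = \<xi>' 0"
  shows "shannon_entropy (garsia_sum \<eta> \<nu> n) + shannon_entropy \<nu>
      + ln (1 - \<delta>) - \<delta> * ln (real (card (set_pmf \<nu>)) / \<delta>) \<le> shannon_entropy (garsia_sum \<eta> \<nu> (Suc n))"
proof -
  define \<Omega> where "\<Omega> = Pi_pmf {..<Suc n} 0 (\<lambda>_. \<nu>)"
  define X where "X = power_sum \<eta> (Suc n)"
  define J where "J = map_pmf (\<lambda>\<xi>. (\<xi> 0, X \<xi>)) \<Omega>"
  have supp: "\<xi> j \<in> set_pmf \<nu>" if "\<xi> \<in> set_pmf \<Omega>" "j < Suc n" for \<xi> j
  proof -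
    have "\<xi> \<in> PiE_dflt {..<Suc n} 0 (\<lambda>_. set_pmf \<nu>)"
      using that(1) by (simp only: \<Omega>_def set_Pi_pmf finite_lessThan comp_def)
    then show ?thesis using that(2) by (auto simp: PiE_dflt_def)
  qed
  have J: "J = map_pmf (\<lambda>(x, y). (x, complex_of_real x + \<eta> * y)) (pair_pmf \<nu> (garsia_sum \<eta> \<nu> n))"
    unfolding J_def \<Omega>_def X_def by (rule map_pmf_first_and_sum)
  have fin\<Omega>: "finite (set_pmf \<Omega>)" unfolding \<Omega>_def by (intro finite_set_Pi_pmf_const fin) simp
  have H_J: "shannon_entropy J = shannon_entropy \<nu> + shannon_entropy (garsia_sum \<eta> \<nu> n)"
    unfolding J using \<open>\<eta> \<noteq> 0\<close> fin
    by (subst shannon_entropy_map_inj) (auto simp: finite_set_garsia_sum shannon_entropy_pair inj_on_def)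
  \<comment> \<open>The decoder picks any good sequence with the observed sum and reads its first
    digit; by \<open>dec\<close> the choice does not matter. It can fail only outside
    \<open>G\<close>.\<close>
  define d where "d x = (SOME \<xi>. \<xi> \<in> G \<and> \<xi> \<in> set_pmf \<Omega> \<and> X \<xi> = x) 0" for x
  have d: "d (X \<xi>) = \<xi> 0" if "\<xi> \<in> G" "\<xi> \<in> set_pmf \<Omega>" for \<xi>
  proof -
    define \<xi>' where "\<xi>' = (SOME \<xi>'. \<xi>' \<in> G \<and> \<xi>' \<in> set_pmf \<Omega> \<and> X \<xi>' = X \<xi>)"
    have "\<xi>' \<in> G \<and> \<xi>' \<in> set_pmf \<Omega> \<and> X \<xi>' = X \<xi>"
      unfolding \<xi>'_def by (rule someI[of _ \<xi>]) (use that in simp)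
    then have "\<xi>' 0 = \<xi> 0" using that supp by (intro dec) (auto simp: X_def)
    then show ?thesis by (simp add: d_def \<xi>'_def)
  qed
  have "measure_pmf.prob J {x. fst x \<noteq> d (snd x)} = measure_pmf.prob \<Omega> ({\<xi>. \<xi> 0 \<noteq> d (X \<xi>)} \<inter> set_pmf \<Omega>)"
    unfolding J_def by (simp add: vimage_def measure_Int_set_pmf)
  also have "\<dots> \<le> measure_pmf.prob \<Omega> (- G)"
    using d by (intro measure_pmf.finite_measure_mono) (auto dest: sym)
  also have "\<dots> \<le> \<delta>" using G by (simp add: \<Omega>_def)
  finally have "shannon_entropy J
      \<le> shannon_entropy (map_pmf snd J) - ln (1 - \<delta>) + \<delta> * ln (real (card (set_pmf \<nu>)) / \<delta>)"
    using fin\<Omega> fin \<delta> supp by (intro fano_inequality) (auto simp: J_def)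
  moreover have "map_pmf snd J = garsia_sum \<eta> \<nu> (Suc n)"
    by (simp add: J_def map_pmf_comp garsia_sum_eq X_def \<Omega>_def)
  ultimately show ?thesis using H_J by simp
qed

section \<open>Second moments and Chebyshev's inequality\<close>

lemma second_moment_Pi_pmf:
  fixes Z :: "'a \<Rightarrow> complex" and c :: "'i \<Rightarrow> complex"
  assumes A: "finite A" and fin: "finite (set_pmf p)"
    and mean: "(\<Sum>x\<in>set_pmf p. of_real (pmf p x) * Z x) = 0"
  shows "measure_pmf.expectation (Pi_pmf A d (\<lambda>_. p)) (\<lambda>\<xi>. (cmod (\<Sum>j\<in>A. c j * Z (\<xi> j)))\<^sup>2)
       = (\<Sum>j\<in>A. (cmod (c j))\<^sup>2) * measure_pmf.expectation p (\<lambda>x. (cmod (Z x))\<^sup>2)"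
  using A
proof (induction A rule: finite_induct)
  case empty
  then show ?case by simp
next
  case (insert i A)
  define V where "V = measure_pmf.expectation p (\<lambda>x. (cmod (Z x))\<^sup>2)"
  define q where "q = Pi_pmf A d (\<lambda>_. p)"
  have finq: "finite (set_pmf q)" unfolding q_def by (intro finite_set_Pi_pmf_const insert fin)
  \<comment> \<open>Average over one coordinate with the contribution \<open>s\<close> of the others
    frozen: the cross term is linear in the centred variable \<open>Z\<close> and vanishes.\<close>
  have one: "(\<Sum>x\<in>set_pmf p. pmf p x * (cmod (b * Z x + s))\<^sup>2) = (cmod b)\<^sup>2 * V + (cmod s)\<^sup>2" for b s
  proof -
    have eq: "(cmod (b * Z x + s))\<^sup>2 = (cmod b)\<^sup>2 * (cmod (Z x))\<^sup>2 + (cmod s)\<^sup>2 + 2 * Re (b * cnj s * Z x)" for x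
      by (simp only: cmod_power2 power_mult_distrib[symmetric] norm_mult[symmetric])
         (simp add: algebra_simps power2_eq_square)
    have "(\<Sum>x\<in>set_pmf p. pmf p x * (cmod (b * Z x + s))\<^sup>2)
        = (\<Sum>x\<in>set_pmf p. (cmod b)\<^sup>2 * (pmf p x * (cmod (Z x))\<^sup>2) + (cmod s)\<^sup>2 * pmf p x
            + 2 * Re (b * cnj s * (of_real (pmf p x) * Z x)))"
      by (intro sum.cong refl) (simp only: eq, simp add: algebra_simps)
    also have "\<dots> = (cmod b)\<^sup>2 * (\<Sum>x\<in>set_pmf p. pmf p x * (cmod (Z x))\<^sup>2) + (cmod s)\<^sup>2 * (\<Sum>x\<in>set_pmf p. pmf p x)
          + 2 * (\<Sum>x\<in>set_pmf p. Re (b * cnj s * (of_real (pmf p x) * Z x)))"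
      by (simp only: sum.distrib sum_distrib_left)
    also have "(\<Sum>x\<in>set_pmf p. Re (b * cnj s * (of_real (pmf p x) * Z x))) = 0"
      by (simp only: Re_sum[symmetric] sum_distrib_left[symmetric] mean) simp
    finally show ?thesis using fin by (simp add: sum_pmf_eq_1 V_def expectation_finite)
  qed
  have "measure_pmf.expectation (Pi_pmf (insert i A) d (\<lambda>_. p)) (\<lambda>\<xi>. (cmod (\<Sum>j\<in>insert i A. c j * Z (\<xi> j)))\<^sup>2)
      = measure_pmf.expectation (pair_pmf p q) (\<lambda>(y, f). (cmod (c i * Z y + (\<Sum>j\<in>A. c j * Z (f j))))\<^sup>2)"
  proof -
    have "(\<Sum>j\<in>A. c j * Z ((f(i := y)) j)) = (\<Sum>j\<in>A. c j * Z (f j))" for f y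
      using insert.hyps by (intro sum.cong) auto
    then show ?thesis
      using insert.hyps by (simp add: Pi_pmf_insert q_def case_prod_unfold)
  qed
  also have "\<dots> = (\<Sum>(y, f)\<in>set_pmf p \<times> set_pmf q.
      pmf p y * pmf q f * (cmod (c i * Z y + (\<Sum>j\<in>A. c j * Z (f j))))\<^sup>2)"
    by (subst expectation_finite) (use fin finq in \<open>auto intro!: sum.cong simp: pmf_pair\<close>)
  also have "\<dots> = (\<Sum>f\<in>set_pmf q. pmf q f * (\<Sum>y\<in>set_pmf p. pmf p y * (cmod (c i * Z y + (\<Sum>j\<in>A. c j * Z (f j))))\<^sup>2))"
    by (subst sum.cartesian_product[symmetric], subst sum.swap) (simp add: sum_distrib_left mult_ac)
  also have "\<dots> = (\<Sum>f\<in>set_pmf q. pmf q f * ((cmod (c i))\<^sup>2 * V + (cmod (\<Sum>j\<in>A. c j * Z (f j)))\<^sup>2))"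
    by (simp only: one)
  also have "\<dots> = (cmod (c i))\<^sup>2 * V + measure_pmf.expectation q (\<lambda>f. (cmod (\<Sum>j\<in>A. c j * Z (f j)))\<^sup>2)"
    using finq by (simp add: expectation_finite distrib_left sum.distrib sum_distrib_right[symmetric] sum_pmf_eq_1)
  also have "measure_pmf.expectation q (\<lambda>f. (cmod (\<Sum>j\<in>A. c j * Z (f j)))\<^sup>2) = (\<Sum>j\<in>A. (cmod (c j))\<^sup>2) * V"
    unfolding q_def V_def by (rule insert.IH)
  finally show ?case using insert.hyps by (simp add: V_def distrib_right)
qed

lemma chebyshev_pmf:
  fixes f :: "'a \<Rightarrow> complex"
  assumes fin: "finite (set_pmf p)" and r: "0 < r"
  shows "measure_pmf.prob p {x. r \<le> cmod (f x)} \<le> measure_pmf.expectation p (\<lambda>x. (cmod (f x))\<^sup>2) / r\<^sup>2"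
proof -
  have "r\<^sup>2 * measure_pmf.prob p {x. r \<le> cmod (f x)}
      = measure_pmf.expectation p (\<lambda>x. r\<^sup>2 * indicator {x. r \<le> cmod (f x)} x)" by simp
  also have "\<dots> \<le> measure_pmf.expectation p (\<lambda>x. (cmod (f x))\<^sup>2)"
    using fin r by (intro integral_mono integrable_measure_pmf_finite) (auto simp: indicator_def power_mono)
  finally show ?thesis using r by (simp add: field_simps)
qed

section \<open>Decoding the first digit\<close>

lemma small_fano_error:
  fixes c e :: real
  assumes "0 < c" "0 < e"
  shows "\<exists>\<delta>. 0 < \<delta> \<and> \<delta> < 1 \<and> - ln (1 - \<delta>) + \<delta> * ln (c / \<delta>) \<le> e"
proof -
  have "((\<lambda>x. - ln (1 - x) + x * ln (c / x)) \<longlongrightarrow> 0) (at_right 0)"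
    using assms(1) by real_asymp
  then have "\<forall>\<^sub>F x in at_right 0. - ln (1 - x) + x * ln (c / x) < e"
    by (rule order_tendstoD) (rule assms(2))
  moreover have "\<forall>\<^sub>F x :: real in at_right 0. x \<in> {0<..<1}"
    by (rule eventually_at_right_real) simp
  ultimately have "\<forall>\<^sub>F x in at_right 0. 0 < x \<and> x < 1 \<and> - ln (1 - x) + x * ln (c / x) \<le> e"
    by eventually_elim auto
  then show ?thesis using eventually_happens'[OF trivial_limit_at_right_real] by blast
qed

lemma ex_positive_lower_bound:
  fixes F :: "real set"
  assumes "finite F" "\<And>x. x \<in> F \<Longrightarrow> 0 < x"
  shows "\<exists>r>0. \<forall>x\<in>F. r \<le> x"
  using assms by (intro exI[of _ "Min (insert 1 F)"]) auto

text \<open>\<open>Y\<close> is the Blaschke functional of the centred digits. For two sequences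
  with equal sums the means cancel and \<open>Y \<xi> - Y \<xi>'\<close> equals the difference of
  the images of the first digits. Where \<open>cmod Y < r\<close> this has modulus below
  \<open>2 * r\<close>, so separation forces equal digits; Chebyshev bounds the probability of the
  complement.\<close>

lemma ex_decoding_event:
  fixes \<nu> :: "real pmf" and \<kappa> :: "complex \<Rightarrow> complex"
  assumes fin: "finite (set_pmf \<nu>)"
    and sep: "\<And>s t. s \<in> set_pmf \<nu> \<Longrightarrow> t \<in> set_pmf \<nu> \<Longrightarrow> s \<noteq> t \<Longrightarrow>
      2 * r \<le> cmod (\<kappa> (of_real s) - \<kappa> (of_real t))"
    and r: "0 < r"
    and S: "finite S" "\<And>z. z \<in> S \<Longrightarrow> cmod z < 1"
    and rel: "\<And>n z a b. z \<in> S \<Longrightarrow> a ` {..<n} \<subseteq> set_pmf \<nu> \<Longrightarrow> b ` {..<n} \<subseteq> set_pmf \<nu> \<Longrightarrow>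
      power_sum \<eta> n a = power_sum \<eta> n b \<Longrightarrow>
      (\<Sum>k<n. (\<kappa> (of_real (a k)) - \<kappa> (of_real (b k))) * z ^ k) = 0"
  defines "m \<equiv> (\<Sum>x\<in>set_pmf \<nu>. of_real (pmf \<nu> x) * \<kappa> (of_real x))"
  assumes small: "(\<Prod>z\<in>S. cmod z)\<^sup>2 * measure_pmf.expectation \<nu> (\<lambda>x. (cmod (\<kappa> (of_real x) - m))\<^sup>2) \<le> \<delta> * r\<^sup>2"
  shows "\<exists>G. measure_pmf.prob (Pi_pmf {..<Suc n} 0 (\<lambda>_. \<nu>)) (- G) \<le> \<delta> \<and>
    (\<forall>\<xi>\<in>G. \<forall>\<xi>'\<in>G. \<xi> ` {..<Suc n} \<subseteq> set_pmf \<nu> \<longrightarrow> \<xi>' ` {..<Suc n} \<subseteq> set_pmf \<nu> \<longrightarrow>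
      power_sum \<eta> (Suc n) \<xi> = power_sum \<eta> (Suc n) \<xi>' \<longrightarrow> \<xi> 0 = \<xi>' 0)"
proof -
  obtain c where c1: "\<And>n. (\<Sum>j<n. (cmod (c j))\<^sup>2) \<le> (\<Prod>a\<in>S. cmod a)\<^sup>2"
    and c2: "\<And>g n. 0 < n \<and> (\<forall>a\<in>S. (\<Sum>j<n. g j * a ^ j) = 0) \<longrightarrow> (\<Sum>j<n. g j * c j) = g 0"
    using ex_vanishing_functional[OF S] by auto
  define \<Omega> where "\<Omega> = Pi_pmf {..<Suc n} 0 (\<lambda>_. \<nu>)"
  define Z where "Z x = \<kappa> (complex_of_real x) - m" for x
  define Y where "Y \<xi> = (\<Sum>j<Suc n. c j * Z (\<xi> j))" for \<xi>
  define V where "V = measure_pmf.expectation \<nu> (\<lambda>x. (cmod (Z x))\<^sup>2)"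
  define G where "G = {\<xi>. cmod (Y \<xi>) < r}"
  have V0: "0 \<le> V" unfolding V_def by (intro integral_nonneg_AE) simp
  have "(\<Sum>x\<in>set_pmf \<nu>. of_real (pmf \<nu> x) * Z x) = m - of_real (\<Sum>x\<in>set_pmf \<nu>. pmf \<nu> x) * m"
    by (simp only: Z_def right_diff_distrib sum_subtractf sum_distrib_right[symmetric] of_real_sum
        m_def[symmetric])
  then have mean: "(\<Sum>x\<in>set_pmf \<nu>. of_real (pmf \<nu> x) * Z x) = 0"
    using fin by (simp add: sum_pmf_eq_1)
  have "- G = {\<xi>. r \<le> cmod (Y \<xi>)}" by (auto simp: G_def)
  then have "measure_pmf.prob \<Omega> (- G) \<le> measure_pmf.expectation \<Omega> (\<lambda>\<xi>. (cmod (Y \<xi>))\<^sup>2) / r\<^sup>2"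
    using chebyshev_pmf[of \<Omega> r Y] r fin by (simp add: \<Omega>_def finite_set_Pi_pmf_const)
  also have "measure_pmf.expectation \<Omega> (\<lambda>\<xi>. (cmod (Y \<xi>))\<^sup>2) = (\<Sum>j<Suc n. (cmod (c j))\<^sup>2) * V"
    unfolding Y_def \<Omega>_def V_def by (intro second_moment_Pi_pmf fin mean) simp
  also have "\<dots> / r\<^sup>2 \<le> \<delta>"
  proof -
    have "(\<Sum>j<Suc n. (cmod (c j))\<^sup>2) * V \<le> (\<Prod>a\<in>S. cmod a)\<^sup>2 * V"
      by (intro mult_right_mono c1 V0)
    also have "\<dots> \<le> \<delta> * r\<^sup>2" using small by (simp add: V_def Z_def)
    finally show ?thesis using r by (simp add: divide_le_eq)
  qed
  finally have prob: "measure_pmf.prob \<Omega> (- G) \<le> \<delta>" .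
  have "\<xi> 0 = \<xi>' 0" if G: "\<xi> \<in> G" "\<xi>' \<in> G"
    and supp: "\<xi> ` {..<Suc n} \<subseteq> set_pmf \<nu>" "\<xi>' ` {..<Suc n} \<subseteq> set_pmf \<nu>"
    and eq: "power_sum \<eta> (Suc n) \<xi> = power_sum \<eta> (Suc n) \<xi>'" for \<xi> \<xi>'
  proof (rule ccontr)
    assume ne: "\<xi> 0 \<noteq> \<xi>' 0"
    define g where "g k = \<kappa> (of_real (\<xi> k)) - \<kappa> (of_real (\<xi>' k))" for k
    have "(\<Sum>j<Suc n. g j * z ^ j) = 0" if "z \<in> S" for z
      unfolding g_def by (rule rel[OF that supp eq])
    then have "(\<Sum>j<Suc n. g j * c j) = g 0" using c2[of "Suc n" g] by blast
    moreover have "(\<Sum>j<Suc n. g j * c j) = Y \<xi> - Y \<xi>'"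
      unfolding Y_def sum_subtractf[symmetric] by (intro sum.cong) (auto simp: g_def Z_def algebra_simps)
    ultimately have "cmod (g 0) \<le> cmod (Y \<xi>) + cmod (Y \<xi>')" by (metis norm_triangle_ineq4)
    also have "\<dots> < 2 * r" using G by (simp add: G_def)
    finally show False using sep[of "\<xi> 0" "\<xi>' 0"] supp ne by (auto simp: g_def)
  qed
  with prob show ?thesis unfolding \<Omega>_def by (intro exI[of _ G]) blast
qed

lemma power_sum_eq_iff:
  "power_sum \<eta> n a = power_sum \<eta> n b \<longleftrightarrow>
     (\<Sum>k<n. (complex_of_real (a k) - complex_of_real (b k)) * \<eta> ^ k) = 0"
  by (simp add: power_sum_def left_diff_distrib sum_subtractf)

text \<open>A multiplicative pigeonhole: if every class product were at least \<open>\<rho>\<close>,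
  the whole product would be at least \<open>\<rho> ^ card R\<close>. An empty class counts with
  product 1.\<close>

lemma ex_small_class:
  fixes k :: "complex \<Rightarrow> 'a"
  assumes "finite S" "finite R" "k ` S \<subseteq> R" "0 \<le> \<rho>" "(\<Prod>z\<in>S. cmod z) < \<rho> ^ card R"
  shows "\<exists>\<kappa>\<in>R. (\<Prod>z | z \<in> S \<and> k z = \<kappa>. cmod z) < \<rho>"
proof (rule ccontr)
  assume "\<not> ?thesis"
  then have "(\<Prod>\<kappa>\<in>R. \<rho>) \<le> (\<Prod>\<kappa>\<in>R. \<Prod>z | z \<in> S \<and> k z = \<kappa>. cmod z)"
    using assms(4) by (intro prod_mono) auto
  also have "\<dots> = (\<Prod>z\<in>S. cmod z)" by (rule prod.group) (use assms in auto)
  finally show False using assms by simp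
qed

lemma garsia_entropy_lower_bound:
  fixes \<nu> :: "real pmf" and h :: real
  assumes fin: "finite (set_pmf \<nu>)" and alg: "\<And>x. x \<in> set_pmf \<nu> \<Longrightarrow> algebraic x"
    and h: "h < shannon_entropy \<nu>"
  shows "\<exists>M>0. \<forall>\<eta>::complex. algebraic \<eta> \<and> \<eta> \<noteq> 0 \<and> mahler_measure_alg \<eta> \<ge> M
           \<longrightarrow> garsia_entropy \<eta> \<nu> \<ge> h"
proof -
  define T where "T = complex_of_real ` set_pmf \<nu>"
  have finT: "finite T" using fin by (simp add: T_def)
  have "\<exists>q. q \<noteq> 0 \<and> poly (of_int_poly q) t = 0" if t: "t \<in> T" for t
  proof -
    obtain x where x: "t = complex_of_real x" "x \<in> set_pmf \<nu>" using t by (auto simp: T_def)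
    then obtain p where p: "\<And>i. poly.coeff p i \<in> \<int>" "p \<noteq> 0" "poly p x = 0"
      using algebraicE[OF alg] by metis
    define q where "q = map_poly floor p"
    have pq: "p = of_int_poly q"
    proof (rule poly_eqI)
      fix i
      from p(1) obtain k where "poly.coeff p i = of_int k" by (auto elim: Ints_cases)
      then show "poly.coeff p i = poly.coeff (of_int_poly q) i" by (simp add: q_def coeff_map_poly)
    qed
    have "poly (of_int_poly q) t = complex_of_real (poly p x)"
      by (simp add: x pq poly_altdef)
    then show ?thesis using p pq by (intro exI[of _ q]) auto
  qed
  then have "\<forall>t\<in>T. \<exists>q. q \<noteq> 0 \<and> poly (of_int_poly q) t = 0" by blast
  then obtain q where q: "\<And>t. t \<in> T \<Longrightarrow> q t \<noteq> 0 \<and> poly (of_int_poly (q t)) t = 0"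
    using bchoice[of T "\<lambda>t q. q \<noteq> 0 \<and> poly (of_int_poly q) t = 0"] by blast
  \<comment> \<open>\<open>R\<close> is the finite list of candidate embeddings. All constants down
    to \<open>M\<close> are fixed from \<open>\<nu>\<close> and \<open>h\<close> before
    \<open>\<eta>\<close> appears.\<close>
  define R where "R = {\<kappa> \<in> PiE T (\<lambda>t. {x::complex. poly (of_int_poly (q t)) x = 0}). inj_on \<kappa> T}"
  have "finite (PiE T (\<lambda>t. {x::complex. poly (of_int_poly (q t)) x = 0}))"
    using q by (intro finite_PiE finT poly_roots_finite) simp
  then have finR: "finite R" unfolding R_def by simp
  obtain C :: int where C: "\<And>\<eta> f n a b. is_min_int_poly \<eta> f \<Longrightarrow> 0 < n \<Longrightarrow> a \<in> {..<n} \<rightarrow> T \<Longrightarrow> b \<in> {..<n} \<rightarrow> T \<Longrightarrow>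
     (\<Sum>k<n. (a k - b k) * \<eta> ^ k) = 0 \<Longrightarrow> a 0 \<noteq> b 0 \<Longrightarrow> \<bar>poly.coeff f 0\<bar> \<le> C"
    using ex_constant_coeff_bound[OF finT q] by blast
  define D where "D = {(\<kappa>, s, t). \<kappa> \<in> R \<and> s \<in> T \<and> t \<in> T \<and> s \<noteq> t}"
  have "finite D" by (rule finite_subset[of _ "R \<times> T \<times> T"]) (auto simp: D_def finR finT)
  then have "\<exists>r>0. \<forall>x\<in>(\<lambda>(\<kappa>, s, t). cmod (\<kappa> s - \<kappa> t)) ` D. r \<le> x"
    by (intro ex_positive_lower_bound) (auto simp: D_def R_def inj_on_def)
  then obtain r' where r': "0 < r'" "\<And>\<kappa> s t. (\<kappa>, s, t) \<in> D \<Longrightarrow> r' \<le> cmod (\<kappa> s - \<kappa> t)"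
    by fastforce
  define r where "r = r' / 2"
  have r: "0 < r" using r' by (simp add: r_def)
  have sep: "2 * r \<le> cmod (\<kappa> s - \<kappa> t)" if "\<kappa> \<in> R" "s \<in> T" "t \<in> T" "s \<noteq> t" for \<kappa> s t
    using r'(2)[of \<kappa> s t] that by (simp add: D_def r_def)
  define m where "m \<kappa> = (\<Sum>x\<in>set_pmf \<nu>. of_real (pmf \<nu> x) * \<kappa> (complex_of_real x))" for \<kappa> :: "complex \<Rightarrow> complex"
  define V where "V \<kappa> = measure_pmf.expectation \<nu> (\<lambda>x. (cmod (\<kappa> (complex_of_real x) - m \<kappa>))\<^sup>2)" for \<kappa>
  have V0: "0 \<le> V \<kappa>" for \<kappa> unfolding V_def by (intro integral_nonneg_AE) simp
  define K where "K = 1 + (\<Sum>\<kappa>\<in>R. V \<kappa>)"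
  have VK: "V \<kappa> \<le> K" if "\<kappa> \<in> R" for \<kappa>
    using member_le_sum[OF that, of V] finR V0 by (simp add: K_def)
  have K0: "0 < K" using sum_nonneg[of R V] V0 by (simp add: K_def add_pos_nonneg)
  have "0 < card (set_pmf \<nu>)" using fin set_pmf_not_empty[of \<nu>] by (simp add: card_gt_0_iff)
  then obtain \<delta> where \<delta>: "0 < \<delta>" "\<delta> < 1"
    "- ln (1 - \<delta>) + \<delta> * ln (real (card (set_pmf \<nu>)) / \<delta>) \<le> shannon_entropy \<nu> - h"
    using small_fano_error[of "real (card (set_pmf \<nu>))" "shannon_entropy \<nu> - h"] h by auto
  \<comment> \<open>\<open>\<rho>\<close> is chosen so that a class product below
    \<open>\<rho>\<close> meets the smallness condition of \<open>ex_decoding_event\<close>, with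
    \<open>K\<close> bounding every variance \<open>V \<kappa>\<close>.\<close>
  define \<rho> where "\<rho> = r * sqrt (\<delta> / K)"
  have \<rho>: "0 < \<rho>" "\<rho>\<^sup>2 * K = \<delta> * r\<^sup>2"
    using r \<delta> K0 by (simp_all add: \<rho>_def power_mult_distrib)
  \<comment> \<open>With the constant coefficient at most \<open>C\<close>, this pushes the product
    of the small conjugates strictly below \<open>\<rho> ^ card R\<close>; the \<open>+ 1\<close>
    makes it strict.\<close>
  define M where "M = (\<bar>real_of_int C\<bar> + 1) / \<rho> ^ card R"
  have M0: "0 < M" using \<rho> by (simp add: M_def add_nonneg_pos)

  have "h \<le> garsia_entropy \<eta> \<nu>"
    if \<eta>: "algebraic \<eta>" "\<eta> \<noteq> 0" "M \<le> mahler_measure_alg \<eta>" for \<eta>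
  proof (rule garsia_entropy_ge[OF fin])
    fix n
    define f where "f = min_int_poly \<eta>"
    have f: "is_min_int_poly \<eta> f"
      unfolding f_def min_int_poly_def by (rule theI'[OF ex1_min_int_poly[OF \<eta>(1)]])
    have "\<exists>G. measure_pmf.prob (Pi_pmf {..<Suc n} 0 (\<lambda>_. \<nu>)) (- G) \<le> \<delta> \<and>
      (\<forall>\<xi>\<in>G. \<forall>\<xi>'\<in>G. \<xi> ` {..<Suc n} \<subseteq> set_pmf \<nu> \<longrightarrow> \<xi>' ` {..<Suc n} \<subseteq> set_pmf \<nu> \<longrightarrow>
        power_sum \<eta> (Suc n) \<xi> = power_sum \<eta> (Suc n) \<xi>' \<longrightarrow> \<xi> 0 = \<xi>' 0)"
    proof (cases "\<exists>n a b. 0 < n \<and> a \<in> {..<n} \<rightarrow> T \<and> b \<in> {..<n} \<rightarrow> T \<and>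
        (\<Sum>k<n. (a k - b k) * \<eta> ^ k) = 0 \<and> a 0 \<noteq> b 0")
      \<comment> \<open>No relation distinguishes first digits, so the sum always determines the
        first digit and the good event can be everything.\<close>
      case False
      have "\<xi> 0 = \<xi>' 0" if "\<xi> ` {..<Suc n} \<subseteq> set_pmf \<nu>" "\<xi>' ` {..<Suc n} \<subseteq> set_pmf \<nu>"
        "power_sum \<eta> (Suc n) \<xi> = power_sum \<eta> (Suc n) \<xi>'" for \<xi> \<xi>'
      proof (rule ccontr)
        assume "\<xi> 0 \<noteq> \<xi>' 0"
        with that have "0 < Suc n \<and> (\<lambda>k. complex_of_real (\<xi> k)) \<in> {..<Suc n} \<rightarrow> T \<and>
          (\<lambda>k. complex_of_real (\<xi>' k)) \<in> {..<Suc n} \<rightarrow> T \<and>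
          (\<Sum>k<Suc n. (complex_of_real (\<xi> k) - complex_of_real (\<xi>' k)) * \<eta> ^ k) = 0 \<and>
          complex_of_real (\<xi> 0) \<noteq> complex_of_real (\<xi>' 0)"
          unfolding power_sum_eq_iff T_def by auto
        with False show False by blast
      qed
      then show ?thesis using \<delta>(1) by (intro exI[of _ UNIV]) simp
    next
      \<comment> \<open>A single such relation, of any length, bounds the constant coefficient of
        \<open>f\<close>.\<close>
      case True
      then have fC: "\<bar>poly.coeff f 0\<bar> \<le> C" using C[OF f] by blast
      define S where "S = {z. poly (of_int_poly f) z = (0::complex) \<and> cmod z < 1}"
      have finS: "finite S" and mS: "mahler_measure f * (\<Prod>z\<in>S. cmod z) = \<bar>real_of_int (poly.coeff f 0)\<bar>"
        using mahler_measure_times_small_roots[OF f] by (simp_all add: S_def)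
      define P where "P z \<kappa> \<longleftrightarrow> (\<forall>n a b. a \<in> {..<n} \<rightarrow> T \<and> b \<in> {..<n} \<rightarrow> T \<and> (\<Sum>k<n. (a k - b k) * \<eta> ^ k) = 0
        \<longrightarrow> (\<Sum>k<n. (\<kappa> (a k) - \<kappa> (b k)) * z ^ k) = (0::complex))" for z \<kappa>
      have "\<exists>\<kappa>. \<kappa> \<in> R \<and> P z \<kappa>" if "z \<in> S" for z
      proof -
        have "poly (of_int_poly f) z = 0" using that by (simp add: S_def)
        from ex_conjugate_relations[OF finT q f this] show ?thesis
          by (auto simp: R_def P_def)
      qed
      \<comment> \<open>\<open>\<phi>\<close> attaches one compatible embedding to each small
        conjugate; its fibres are the classes for the pigeonhole.\<close>
      then obtain \<phi> where \<phi>: "\<And>z. z \<in> S \<Longrightarrow> \<phi> z \<in> R" "\<And>z. z \<in> S \<Longrightarrow> P z (\<phi> z)" by metis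
      have "M * (\<Prod>z\<in>S. cmod z) \<le> mahler_measure f * (\<Prod>z\<in>S. cmod z)"
        using \<eta>(3) by (intro mult_right_mono prod_nonneg) (simp_all add: mahler_measure_alg_def f_def)
      also have "\<dots> < \<bar>real_of_int C\<bar> + 1" using fC unfolding mS by linarith
      finally have "(\<bar>real_of_int C\<bar> + 1) * (\<Prod>z\<in>S. cmod z) < (\<bar>real_of_int C\<bar> + 1) * \<rho> ^ card R"
        using \<rho>(1) by (simp add: M_def pos_divide_less_eq)
      then have "(\<Prod>z\<in>S. cmod z) < \<rho> ^ card R" by (rule mult_left_less_imp_less) simp
      then have "\<exists>\<kappa>\<in>R. (\<Prod>z | z \<in> S \<and> \<phi> z = \<kappa>. cmod z) < \<rho>"
        using \<phi>(1) \<rho>(1) by (intro ex_small_class finS finR) auto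
      then obtain \<kappa> where \<kappa>: "\<kappa> \<in> R" "(\<Prod>z | z \<in> S \<and> \<phi> z = \<kappa>. cmod z) < \<rho>" by blast
      have "(\<Prod>z | z \<in> S \<and> \<phi> z = \<kappa>. cmod z)\<^sup>2 * V \<kappa> \<le> \<rho>\<^sup>2 * K"
        using \<kappa> VK V0 by (intro mult_mono power_mono prod_nonneg) auto
      then have small: "(\<Prod>z | z \<in> S \<and> \<phi> z = \<kappa>. cmod z)\<^sup>2 * V \<kappa> \<le> \<delta> * r\<^sup>2" by (simp add: \<rho>(2))
      show ?thesis
      proof (rule ex_decoding_event[where r = r and \<kappa> = \<kappa> and S = "{z. z \<in> S \<and> \<phi> z = \<kappa>}"])
        show "finite {z. z \<in> S \<and> \<phi> z = \<kappa>}" using finS by simp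
        show "2 * r \<le> cmod (\<kappa> (of_real s) - \<kappa> (of_real t))"
          if "s \<in> set_pmf \<nu>" "t \<in> set_pmf \<nu>" "s \<noteq> t" for s t
          using that by (intro sep \<kappa>(1)) (auto simp: T_def)
        show "(\<Sum>k<n. (\<kappa> (of_real (a k)) - \<kappa> (of_real (b k))) * z ^ k) = 0"
          if "z \<in> {z. z \<in> S \<and> \<phi> z = \<kappa>}" "a ` {..<n} \<subseteq> set_pmf \<nu>" "b ` {..<n} \<subseteq> set_pmf \<nu>"
            "power_sum \<eta> n a = power_sum \<eta> n b" for n z a b
        proof -
          have "P z \<kappa>" using \<phi>(2) that(1) by blast
          moreover have "(\<lambda>k. complex_of_real (a k)) \<in> {..<n} \<rightarrow> T" "(\<lambda>k. complex_of_real (b k)) \<in> {..<n} \<rightarrow> T"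
            using that(2,3) by (auto simp: T_def)
          moreover have "(\<Sum>k<n. (complex_of_real (a k) - complex_of_real (b k)) * \<eta> ^ k) = 0"
            using that(4) by (simp only: power_sum_eq_iff)
          ultimately show ?thesis unfolding P_def by blast
        qed
      qed (use fin r small in \<open>auto simp: S_def V_def m_def\<close>)
    qed
    then obtain G where G: "measure_pmf.prob (Pi_pmf {..<Suc n} 0 (\<lambda>_. \<nu>)) (- G) \<le> \<delta>"
      "\<And>\<xi> \<xi>'. \<xi> \<in> G \<Longrightarrow> \<xi>' \<in> G \<Longrightarrow> \<xi> ` {..<Suc n} \<subseteq> set_pmf \<nu> \<Longrightarrow> \<xi>' ` {..<Suc n} \<subseteq> set_pmf \<nu> \<Longrightarrow>
        power_sum \<eta> (Suc n) \<xi> = power_sum \<eta> (Suc n) \<xi>' \<Longrightarrow> \<xi> 0 = \<xi>' 0"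
      by blast
    have "shannon_entropy (garsia_sum \<eta> \<nu> n) + shannon_entropy \<nu>
      + ln (1 - \<delta>) - \<delta> * ln (real (card (set_pmf \<nu>)) / \<delta>) \<le> shannon_entropy (garsia_sum \<eta> \<nu> (Suc n))"
      by (rule shannon_entropy_garsia_sum_Suc_ge[OF fin \<eta>(2) \<delta>(1,2) G(1)]) (rule G(2))
    then show "shannon_entropy (garsia_sum \<eta> \<nu> n) + h \<le> shannon_entropy (garsia_sum \<eta> \<nu> (Suc n))"
      using \<delta>(3) by linarith
  qed
  with M0 show ?thesis by blast
qed

section \<open>The entropy of the digit law and the final statement\<close>

lemma shannon_entropy_discrete_law:
  assumes "inj_on t {1..m}" "\<And>j. j \<in> {1..m} \<Longrightarrow> 0 \<le> p j" "(\<Sum>j\<in>{1..m}. p j) = 1"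
  shows "set_pmf (discrete_law m p t) \<subseteq> t ` {1..m}"
    and "shannon_entropy (discrete_law m p t) = entropy_vector m p"
proof -
  let ?\<nu> = "discrete_law m p t"
  have pmf: "pmf ?\<nu> x = (\<Sum>j\<in>{1..m}. p j * indicator {t j} x)" for x
    using pmf_discrete_law[of m p t x] assms(2,3) by blast
  show sub: "set_pmf ?\<nu> \<subseteq> t ` {1..m}"
  proof
    fix x assume "x \<in> set_pmf ?\<nu>"
    then have "(\<Sum>j\<in>{1..m}. p j * indicator {t j} x) \<noteq> 0" by (simp add: set_pmf_iff pmf)
    then obtain j where "j \<in> {1..m}" "p j * indicator {t j} x \<noteq> 0" by (meson sum.not_neutral_contains_not_neutral)
    then show "x \<in> t ` {1..m}" by (auto simp: indicator_def split: if_splits)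
  qed
  have pt: "pmf ?\<nu> (t j) = p j" if "j \<in> {1..m}" for j
  proof -
    have "pmf ?\<nu> (t j) = (\<Sum>i\<in>{1..m}. if i = j then p i else 0)"
      unfolding pmf using that inj_onD[OF assms(1)] by (intro sum.cong refl) (auto simp: indicator_def)
    then show ?thesis using that by simp
  qed
  have "shannon_entropy ?\<nu> = (\<Sum>x\<in>set_pmf ?\<nu>. pmf ?\<nu> x * - ln (pmf ?\<nu> x))"
    by (rule shannon_entropy_finite) (use sub finite_subset in blast)
  \<comment> \<open>Points with \<open>p j = 0\<close> lie outside the support, but they contribute
    0 to the sum.\<close>
  also have "\<dots> = (\<Sum>x\<in>t ` {1..m}. pmf ?\<nu> x * - ln (pmf ?\<nu> x))"
    using sub by (intro sum.mono_neutral_left) (auto simp: set_pmf_iff)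
  also have "\<dots> = (\<Sum>j\<in>{1..m}. p j * - ln (p j))"
    unfolding sum.reindex[OF assms(1)] comp_def using pt by (intro sum.cong) simp_all
  finally show "shannon_entropy ?\<nu> = entropy_vector m p" by (simp add: entropy_vector_def sum_negf)
qed

theorem theorem1p4:
  fixes m :: nat and t p :: "nat \<Rightarrow> real" and h :: real
  assumes "\<And>j. j \<in> {1..m} \<Longrightarrow> algebraic (t j)"
    and "inj_on t {1..m}"
    and "\<And>j. j \<in> {1..m} \<Longrightarrow> 0 \<le> p j"
    and "(\<Sum>j\<in>{1..m}. p j) = 1"
    and "0 < h" and "h < entropy_vector m p"
  shows "\<exists>M>0. \<forall>\<eta>::real.
           algebraic \<eta> \<and> \<eta> \<noteq> 0 \<and> -1 < \<eta> \<and> \<eta> < 1 \<and> mahler_measure_alg (complex_of_real \<eta>) \<ge> M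
           \<longrightarrow> garsia_entropy (complex_of_real \<eta>) (discrete_law m p t) \<ge> h"
proof -
  let ?\<nu> = "discrete_law m p t"
  have supp: "set_pmf ?\<nu> \<subseteq> t ` {1..m}" and H: "shannon_entropy ?\<nu> = entropy_vector m p"
    using shannon_entropy_discrete_law[OF assms(2,3,4)] by blast+
  have "finite (set_pmf ?\<nu>)" by (rule finite_subset[OF supp]) simp
  moreover have "algebraic x" if "x \<in> set_pmf ?\<nu>" for x using that supp assms(1) by blast
  ultimately obtain M where M: "0 < M" "\<And>\<eta>::complex. algebraic \<eta> \<Longrightarrow> \<eta> \<noteq> 0 \<Longrightarrow>
      M \<le> mahler_measure_alg \<eta> \<Longrightarrow> h \<le> garsia_entropy \<eta> ?\<nu>"
    using garsia_entropy_lower_bound[of ?\<nu> h] assms(6) unfolding H by blast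
  have "algebraic (complex_of_real \<eta>)" if "algebraic \<eta>" for \<eta> by (rule algebraic_of_real) (rule that)
  with M show ?thesis by (intro exI[of _ M]) auto
qed

end
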